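(* Let $n\ge1$ and $H\in(0,1)$. Let $B^1,\dots,B^n$ be standard Brownian motions and $B_H$ a fractional Brownian motion with Hurst parameter $H$, all independent. Let $q=q(x_1,\dots,x_n,t)$ be the density of the law of the $n$-dimensional vector process $$\left(B^1(|B_H(t)|),\dots,B^n(|B_H(t)|)\right),\qquad t>0 .$$ Then $$\frac{\partial q}{\partial t}=\frac{H\,t^{2H-1}}{\sqrt{2\pi t^{2H}}}\,\triangle\,\delta(x_1)\cdots\delta(x_n)+\frac{H\,t^{2H-1}}{2^2}\,\triangle^2 q,\qquad x\in\mathbb{R}^n,\ t>0 .$$
   Context: A fractional Brownian motion $B_H$ with Hurst parameter $H\in(0,1)$ is a centred Gaussian process with covariance $E\{B_H(s)B_H(t)\}=\frac12\left(|t|^{2H}+|s|^{2H}-|t-s|^{2H}\right)$. Here $\triangle=\sum_{j=1}^n\frac{\partial^2}{\partial x_j^2}$, $\triangle^2=\triangle\triangle$, and $\delta(x_1)\cdots\delta(x_n)$ is the Dirac delta at the origin of $\mathbb{R}^n$, so that $\triangle\,\delta(x_1)\cdots\delta(x_n)$ is the distribution $\phi\mapsto(\triangle\phi)(0)$. The equation, which contains this term, is understood in the sense of distributions in $x\in\mathbb{R}^n$. *)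

theory Defs
  imports "HOL-Probability.Probability"
begin

text \<open>The case of zero variance (a constant) is included, as usual for Gaussian processes.\<close>
definition gaussian_rv :: "'w measure \<Rightarrow> ('w \<Rightarrow> real) \<Rightarrow> bool" where
  "gaussian_rv M X \<longleftrightarrow> X \<in> borel_measurable M \<and>
     (\<exists>\<mu> \<sigma>. (\<sigma> > 0 \<and> distributed M lborel X (\<lambda>x. ennreal (normal_density \<mu> \<sigma> x))) \<or>
            (\<sigma> = 0 \<and> (AE \<omega> in M. X \<omega> = \<mu>)))"

definition gaussian_process :: "'w measure \<Rightarrow> real set \<Rightarrow> (real \<Rightarrow> 'w \<Rightarrow> real) \<Rightarrow> bool" where
  "gaussian_process M T X \<longleftrightarrow>
     (\<forall>I c. finite I \<and> I \<subseteq> T \<longrightarrow> gaussian_rv M (\<lambda>\<omega>. \<Sum>t\<in>I. c t * X t \<omega>))"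

definition fractional_brownian_motion ::
    "'w measure \<Rightarrow> real \<Rightarrow> (real \<Rightarrow> 'w \<Rightarrow> real) \<Rightarrow> bool" where
  "fractional_brownian_motion M H X \<longleftrightarrow>
     gaussian_process M {0..} X \<and>
     (\<forall>t\<ge>0. (LINT \<omega>|M. X t \<omega>) = 0) \<and>
     (\<forall>s\<ge>0. \<forall>t\<ge>0. (LINT \<omega>|M. X s \<omega> * X t \<omega>) =
        (1/2) * (\<bar>t\<bar> powr (2*H) + \<bar>s\<bar> powr (2*H) - \<bar>t - s\<bar> powr (2*H)))"

definition standard_brownian_motion :: "'w measure \<Rightarrow> (real \<Rightarrow> 'w \<Rightarrow> real) \<Rightarrow> bool" where
  "standard_brownian_motion M W \<longleftrightarrow>
     (\<forall>t\<ge>0. W t \<in> borel_measurable M) \<and>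
     (AE \<omega> in M. W 0 \<omega> = 0) \<and>
     (\<forall>(k::nat) \<tau>. 0 \<le> \<tau> 0 \<and> (\<forall>i<k. \<tau> i < \<tau> (Suc i)) \<longrightarrow>
        prob_space.indep_vars M (\<lambda>_. borel) (\<lambda>i \<omega>. W (\<tau> (Suc i)) \<omega> - W (\<tau> i) \<omega>) {..<k}) \<and>
     (\<forall>s t. 0 \<le> s \<and> s < t \<longrightarrow>
        distributed M lborel (\<lambda>\<omega>. W t \<omega> - W s \<omega>)
          (\<lambda>x. ennreal (normal_density 0 (sqrt (t - s)) x))) \<and>
     (AE \<omega> in M. continuous_on {0..} (\<lambda>t. W t \<omega>))"

text \<open>Independence of whole processes: each one is a random element of the path space
  with its product sigma-algebra. The index \<^term>\<open>None\<close> stands for the process \<open>Y\<close>.\<close>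
definition independent_processes ::
    "'w measure \<Rightarrow> ('n \<Rightarrow> real \<Rightarrow> 'w \<Rightarrow> real) \<Rightarrow> (real \<Rightarrow> 'w \<Rightarrow> real) \<Rightarrow> bool" where
  "independent_processes M W Y \<longleftrightarrow>
     prob_space.indep_vars M (\<lambda>_. Pi\<^sub>M {0..} (\<lambda>_. borel))
       (\<lambda>k \<omega>. \<lambda>t\<in>{0..}. (case k of None \<Rightarrow> Y t \<omega> | Some j \<Rightarrow> W j t \<omega>))
       (UNIV :: 'n option set)"

definition partial_deriv :: "'n::finite \<Rightarrow> (real^'n \<Rightarrow> real) \<Rightarrow> real^'n \<Rightarrow> real" where
  "partial_deriv j f x = deriv (\<lambda>h. f (x + h *\<^sub>R axis j 1)) 0"

definition laplacian :: "(real^'n::finite \<Rightarrow> real) \<Rightarrow> real^'n \<Rightarrow> real" where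
  "laplacian f x = (\<Sum>j\<in>UNIV. partial_deriv j (partial_deriv j f) x)"

text \<open>Infinite differentiability: every iterated partial derivative, \<open>f\<close> included, is
  (Frechet) differentiable everywhere, hence in particular continuous.\<close>
definition smooth :: "(real^'n::finite \<Rightarrow> real) \<Rightarrow> bool" where
  "smooth f \<longleftrightarrow> (\<forall>js x. foldr partial_deriv js f differentiable (at x))"

definition test_function :: "(real^'n::finite \<Rightarrow> real) \<Rightarrow> bool" where
  "test_function \<phi> \<longleftrightarrow> smooth \<phi> \<and> compact (closure {x. \<phi> x \<noteq> 0})"

text \<open>Distributions are represented by their action; only their values on test functions matter.\<close>
type_synonym 'n distribution = "(real^'n \<Rightarrow> real) \<Rightarrow> real"

definition regular_distribution :: "(real^'n::finite \<Rightarrow> real) \<Rightarrow> 'n distribution" where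
  "regular_distribution f \<phi> = (LINT x|lborel. f x * \<phi> x)"

definition dirac_delta :: "'n::finite distribution" where
  "dirac_delta \<phi> = \<phi> 0"

text \<open>No sign appears since the Laplacian has even order.\<close>
definition distribution_laplacian :: "'n::finite distribution \<Rightarrow> 'n distribution" where
  "distribution_laplacian T \<phi> = T (laplacian \<phi>)"

end

theory Submission
  imports Defs
begin

text \<open>For a test function \<open>f\<close> let \<open>u s\<close> be the expectation of \<open>f\<close> under the centred normal law on
  \<open>\<real>\<^sup>n\<close> with covariance \<open>s I\<close>; Stein's identity gives \<open>u' = v / 2\<close>, where \<open>v\<close> is the same expectation for
  the Laplacian of \<open>f\<close>. By independence and path continuity, pairing \<open>q\<close> with \<open>f\<close> at time \<open>t\<close> gives
  \<open>E u (\<bar>B\<^sub>H t\<bar>)\<close>, which equals \<open>2 E [u (t\<^sup>H Z); Z > 0]\<close> for a standard normal \<open>Z\<close>. Its derivative is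
  \<open>H t powr (H - 1) E [Z v (t\<^sup>H Z); Z > 0]\<close>, and a Gaussian integration by parts on the half-line turns this
  into the boundary term \<open>v 0 / sqrt (2 pi)\<close>, the Dirac contribution, plus a term with \<open>v'\<close>, the bi-Laplacian
  contribution.\<close>

section \<open>Differentiation under the integral and Stein's identity\<close>

text \<open>Along any sequence tending to \<open>t\<close> the difference quotients are dominated by
  \<open>g\<close>, by the mean value inequality on the interval, so dominated convergence applies.
  This is why \<open>f'\<close> is bounded on a whole neighbourhood of \<open>t\<close>.\<close>

lemma has_real_derivative_integral:
  fixes f f' :: "real \<Rightarrow> 'a \<Rightarrow> real"
  assumes t: "t \<in> {a<..<b}"
    and int: "\<And>s. s \<in> {a<..<b} \<Longrightarrow> integrable M (f s)"
    and der: "\<And>s x. s \<in> {a<..<b} \<Longrightarrow> x \<in> space M \<Longrightarrow>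
                ((\<lambda>s. f s x) has_real_derivative f' s x) (at s)"
    and bound: "\<And>s x. s \<in> {a<..<b} \<Longrightarrow> x \<in> space M \<Longrightarrow> \<bar>f' s x\<bar> \<le> g x"
    and meas: "f' t \<in> borel_measurable M"
    and g: "integrable M g"
  shows "((\<lambda>s. LINT x|M. f s x) has_real_derivative (LINT x|M. f' t x)) (at t)"
proof -
  have "((\<lambda>s. ((LINT x|M. f s x) - (LINT x|M. f t x)) / (s - t)) \<longlongrightarrow> (LINT x|M. f' t x))
          (at t within {a<..<b})"
    unfolding tendsto_at_iff_sequentially
  proof (intro allI impI)
    fix X :: "nat \<Rightarrow> real"
    assume X: "\<forall>i. X i \<in> {a<..<b} - {t}" and lim: "X \<longlonglongrightarrow> t"
    have "(\<lambda>i. LINT x|M. (f (X i) x - f t x) / (X i - t)) \<longlonglongrightarrow> (LINT x|M. f' t x)"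
    proof (rule integral_dominated_convergence[where w = g])
      show "(\<lambda>x. (f (X i) x - f t x) / (X i - t)) \<in> borel_measurable M" for i
        using int[of "X i"] int[OF t] X by (intro borel_measurable_divide) auto
      show "AE x in M. (\<lambda>i. (f (X i) x - f t x) / (X i - t)) \<longlonglongrightarrow> f' t x"
      proof (rule AE_I2)
        fix x assume "x \<in> space M"
        from der[OF t this] have "((\<lambda>s. (f s x - f t x) / (s - t)) \<longlongrightarrow> f' t x) (at t)"
          by (simp add: has_field_derivative_iff)
        with X lim show "(\<lambda>i. (f (X i) x - f t x) / (X i - t)) \<longlonglongrightarrow> f' t x"
          unfolding tendsto_at_iff_sequentially by (auto simp: o_def)
      qed
      show "AE x in M. norm ((f (X i) x - f t x) / (X i - t)) \<le> g x" for i
      proof (rule AE_I2)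
        fix x assume x: "x \<in> space M"
        have "norm (f (X i) x - f t x) \<le> g x * norm (X i - t)"
        proof (rule field_differentiable_bound[where S = "{a<..<b}" and f' = "\<lambda>s. f' s x"])
          show "((\<lambda>s. f s x) has_field_derivative f' s x) (at s within {a<..<b})"
            if "s \<in> {a<..<b}" for s
            using der[OF that x] by (rule has_field_derivative_at_within)
        qed (use X t bound x in auto)
        moreover have "X i \<noteq> t" using X by auto
        ultimately show "norm ((f (X i) x - f t x) / (X i - t)) \<le> g x"
          by (simp add: divide_simps)
      qed
    qed (use meas g in auto)
    also have "(\<lambda>i. LINT x|M. (f (X i) x - f t x) / (X i - t)) =
        (\<lambda>s. ((LINT x|M. f s x) - (LINT x|M. f t x)) / (s - t)) \<circ> X"
    proof
      fix i
      from X have "X i \<in> {a<..<b}" by auto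
      from int[OF this] int[OF t]
      show "(LINT x|M. (f (X i) x - f t x) / (X i - t)) =
          ((\<lambda>s. ((LINT x|M. f s x) - (LINT x|M. f t x)) / (s - t)) \<circ> X) i"
        by (simp add: Bochner_Integration.integral_diff)
    qed
    finally show "((\<lambda>s. ((LINT x|M. f s x) - (LINT x|M. f t x)) / (s - t)) \<circ> X)
        \<longlonglongrightarrow> (LINT x|M. f' t x)" .
  qed
  moreover have "at t within {a<..<b} = at t"
    using t by (intro at_within_open) auto
  ultimately show ?thesis by (simp add: has_field_derivative_iff)
qed

section \<open>Gaussian integration by parts in one dimension\<close>

lemma std_normal_density_has_real_derivative:
  "(std_normal_density has_real_derivative - x * std_normal_density x) (at x)"
  unfolding std_normal_density_def
  by (auto intro!: derivative_eq_intros simp: field_simps power2_eq_square)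

text \<open>The dominating function is a multiple of the absolute moment integrand of order
  \<open>k\<close>; the cases \<open>k = 0\<close> and \<open>k = 1\<close> are applied
  below.\<close>

lemma integrable_std_normal_times_bounded:
  fixes g :: "real \<Rightarrow> real"
  assumes [measurable]: "g \<in> borel_measurable borel" and "\<And>x. \<bar>g x\<bar> \<le> C"
  shows "integrable lborel (\<lambda>x. std_normal_density x * x ^ k * g x)"
proof (rule Bochner_Integration.integrable_bound)
  show "integrable lborel (\<lambda>x. C * (std_normal_density x * \<bar>x\<bar> ^ k))"
    using integrable_std_normal_moment_abs[of k] by simp
  show "AE x in lborel. norm (std_normal_density x * x ^ k * g x)
      \<le> norm (C * (std_normal_density x * \<bar>x\<bar> ^ k))"
  proof (rule AE_I2)
    fix x
    have "\<bar>g x\<bar> \<le> \<bar>C\<bar>" using assms(2)[of x] by linarith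
    then have "(std_normal_density x * \<bar>x\<bar> ^ k) * \<bar>g x\<bar> \<le> (std_normal_density x * \<bar>x\<bar> ^ k) * \<bar>C\<bar>"
      by (intro mult_left_mono) auto
    then show "norm (std_normal_density x * x ^ k * g x)
      \<le> norm (C * (std_normal_density x * \<bar>x\<bar> ^ k))"
      by (simp add: abs_mult power_abs mult.commute)
  qed
qed simp

lemma std_normal_density_tendsto_0: "(std_normal_density \<longlongrightarrow> 0) at_top" "(std_normal_density \<longlongrightarrow> 0) at_bot"
proof -
  have *: "(std_normal_density \<longlongrightarrow> 0) F" if "filterlim (\<lambda>x::real. x\<^sup>2) at_top F" for F
  proof -
    have "filterlim (\<lambda>x::real. 1/2 * x\<^sup>2) at_top F"
      by (rule filterlim_tendsto_pos_mult_at_top[OF tendsto_const _ that]) simp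
    then have "filterlim (\<lambda>x::real. - (1/2 * x\<^sup>2)) at_bot F"
      unfolding filterlim_uminus_at_bot by simp
    from tendsto_mult[OF tendsto_const[of "1 / sqrt (2 * pi)"] filterlim_compose[OF exp_at_bot this]]
    show ?thesis by (simp add: std_normal_density_def[abs_def])
  qed
  show "(std_normal_density \<longlongrightarrow> 0) at_top"
    by (intro * filterlim_pow_at_top filterlim_ident) simp
  show "(std_normal_density \<longlongrightarrow> 0) at_bot"
    by (intro * filterlim_pow_at_bot_even filterlim_ident) simp_all
qed

text \<open>With \<open>n\<close> the normal density, \<open>- n g\<close> has derivative
  \<open>n (x g - g')\<close>, so this is the fundamental theorem of calculus on the interval from
  \<open>a\<close> to infinity: boundedness of \<open>g\<close> kills the term at infinity, and
  \<open>L\<close> is the term at \<open>a\<close>. An extended real \<open>a\<close> covers both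
  the whole line and the half-line.\<close>

lemma stein_interval:
  fixes g g' :: "real \<Rightarrow> real" and a :: ereal
  assumes a: "a < \<infinity>"
    and der: "\<And>x. a < ereal x \<Longrightarrow> (g has_real_derivative g' x) (at x)"
    and cont: "\<And>x. a < ereal x \<Longrightarrow> isCont g' x"
    and bound: "\<And>x. a < ereal x \<Longrightarrow> \<bar>g x\<bar> \<le> C" "\<And>x. a < ereal x \<Longrightarrow> \<bar>g' x\<bar> \<le> C"
    and meas [measurable]: "g \<in> borel_measurable borel" "g' \<in> borel_measurable borel"
    and lim: "(((\<lambda>x. std_normal_density x * g x) \<circ> real_of_ereal) \<longlongrightarrow> L) (at_right a)"
  shows "(LINT x|lborel. indicator (einterval a \<infinity>) x * (std_normal_density x * (x * g x))) =
     L + (LINT x|lborel. indicator (einterval a \<infinity>) x * (std_normal_density x * g' x))"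
proof -
  let ?n = std_normal_density and ?I = "indicator (einterval a \<infinity>) :: real \<Rightarrow> real"
  \<comment> \<open>The bounds on \<open>g\<close> and \<open>g'\<close> hold only to the right of
    \<open>a\<close>. Cutting off by the indicator makes them global; \<open>\<bar>C\<bar>\<close>
    also bounds the value 0 outside the interval.\<close>
  have ind: "\<bar>?I x * h x\<bar> \<le> \<bar>C\<bar>" if "\<And>x. a < ereal x \<Longrightarrow> \<bar>h x\<bar> \<le> C" for h :: "real \<Rightarrow> real" and x
    using that[of x] by (auto simp: indicator_def einterval_def)
  have 1: "integrable lborel (\<lambda>x. ?I x * (?n x * (x * g x)))"
    using integrable_std_normal_times_bounded[of "\<lambda>x. ?I x * g x" "\<bar>C\<bar>" 1] ind[of g] bound(1)
    by (simp add: mult_ac)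
  have 2: "integrable lborel (\<lambda>x. ?I x * (?n x * g' x))"
    using integrable_std_normal_times_bounded[of "\<lambda>x. ?I x * g' x" "\<bar>C\<bar>" 0] ind[of g'] bound(2)
    by (simp add: mult_ac)
  have "(LBINT x=a..\<infinity>. ?n x * (x * g x) - ?n x * g' x) = 0 - (- L)"
  proof (rule interval_integral_FTC_integrable[where F = "\<lambda>x. - (?n x * g x)"])
    show "((\<lambda>x. - (?n x * g x)) has_vector_derivative (?n x * (x * g x) - ?n x * g' x)) (at x)"
      if "a < ereal x" for x
      unfolding has_real_derivative_iff_has_vector_derivative[symmetric]
      by (auto intro!: derivative_eq_intros std_normal_density_has_real_derivative der[OF that]
          simp: field_simps)
    show "isCont (\<lambda>x. ?n x * (x * g x) - ?n x * g' x) x" if "a < ereal x" for x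
      using DERIV_isCont[OF der[OF that]] cont[OF that]
        DERIV_isCont[OF std_normal_density_has_real_derivative]
      by (intro continuous_intros) auto
    show "set_integrable lborel (einterval a \<infinity>) (\<lambda>x. ?n x * (x * g x) - ?n x * g' x)"
      using Bochner_Integration.integrable_diff[OF 1 2] by (simp add: set_integrable_def algebra_simps)
    show "(((\<lambda>x. - (?n x * g x)) \<circ> real_of_ereal) \<longlongrightarrow> - L) (at_right a)"
      using tendsto_minus[OF lim] by (simp add: o_def)
    \<comment> \<open>Since \<open>a\<close> may be \<open>-\<infinity>\<close>, a real point beyond
      it is chosen, from which the comparison with \<open>\<bar>C\<bar> * ?n x\<close>
      starts.\<close>
    have "\<exists>r. a < ereal r" using a
      using ereal_dense2 by blast
    then obtain r where r: "a < ereal r" ..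
    have "((\<lambda>x. ?n x * g x) \<longlongrightarrow> 0) at_top"
    proof (rule Lim_null_comparison)
      show "((\<lambda>x. \<bar>C\<bar> * ?n x) \<longlongrightarrow> 0) at_top"
        using tendsto_mult_right_zero[OF std_normal_density_tendsto_0(1)] by simp
      show "\<forall>\<^sub>F x in at_top. norm (?n x * g x) \<le> \<bar>C\<bar> * ?n x"
      proof (rule eventually_mono[OF eventually_ge_at_top[of r]])
        fix x assume "r \<le> x"
        then have "a < ereal x" using r by (meson ereal_less_eq(3) order_less_le_trans)
        from bound(1)[OF this] have "\<bar>g x\<bar> * ?n x \<le> \<bar>C\<bar> * ?n x" by (intro mult_right_mono) auto
        then show "norm (?n x * g x) \<le> \<bar>C\<bar> * ?n x" by (simp add: abs_mult mult.commute)
      qed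
    qed
    from tendsto_minus[OF this] show "(((\<lambda>x. - (?n x * g x)) \<circ> real_of_ereal) \<longlongrightarrow> 0) (at_left \<infinity>)"
      by (simp add: ereal_tendsto_simps)
  qed (use a in auto)
  moreover have "(LBINT x=a..\<infinity>. ?n x * (x * g x) - ?n x * g' x) =
      (LINT x|lborel. ?I x * (?n x * (x * g x)) - ?I x * (?n x * g' x))"
    using a by (simp add: interval_lebesgue_integral_def set_lebesgue_integral_def algebra_simps)
  ultimately show ?thesis
    using Bochner_Integration.integral_diff[OF 1 2] by simp
qed

text \<open>The case \<open>a = -\<infinity>\<close>: boundedness of \<open>g\<close> makes the
  boundary term vanish at this end too, so \<open>L = 0\<close>.\<close>

lemma stein_identity:
  fixes g g' :: "real \<Rightarrow> real"
  assumes der: "\<And>x. (g has_real_derivative g' x) (at x)"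
    and cont: "\<And>x. isCont g' x"
    and bound: "\<And>x. \<bar>g x\<bar> \<le> C" "\<And>x. \<bar>g' x\<bar> \<le> C"
  shows "(LINT x|lborel. std_normal_density x * (x * g x)) =
     (LINT x|lborel. std_normal_density x * g' x)"
proof -
  have [measurable]: "g \<in> borel_measurable borel" "g' \<in> borel_measurable borel"
    using cont DERIV_isCont[OF der]
    by (auto intro!: borel_measurable_continuous_onI simp: continuous_on_eq_continuous_at)
  have "((\<lambda>x. std_normal_density x * g x) \<longlongrightarrow> 0) at_bot"
  proof (rule Lim_null_comparison)
    show "((\<lambda>x. \<bar>C\<bar> * std_normal_density x) \<longlongrightarrow> 0) at_bot"
      using tendsto_mult_right_zero[OF std_normal_density_tendsto_0(2)] by simp
    have "\<bar>g x\<bar> * std_normal_density x \<le> \<bar>C\<bar> * std_normal_density x" for x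
      using bound(1)[of x] by (intro mult_right_mono) auto
    then show "\<forall>\<^sub>F x in at_bot. norm (std_normal_density x * g x) \<le> \<bar>C\<bar> * std_normal_density x"
      by (simp add: abs_mult mult.commute)
  qed
  then show ?thesis
    using stein_interval[of "-\<infinity>" g g' C 0] assms by (simp add: ereal_tendsto_simps)
qed

text \<open>The boundary term is the density at 0, \<open>1 / sqrt (2 * pi)\<close>, times the right
  limit of \<open>g\<close>. Derivatives are asked for only at \<open>x > 0\<close> because
  \<open>heat\<close> will be differentiated only at positive times.\<close>

lemma stein_identity_half_line:
  fixes g g' :: "real \<Rightarrow> real"
  assumes der: "\<And>x. x > 0 \<Longrightarrow> (g has_real_derivative g' x) (at x)"
    and cont: "\<And>x. x > 0 \<Longrightarrow> isCont g' x"
    and bound: "\<And>x. x > 0 \<Longrightarrow> \<bar>g x\<bar> \<le> C" "\<And>x. x > 0 \<Longrightarrow> \<bar>g' x\<bar> \<le> C"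
    and meas: "g \<in> borel_measurable borel" "g' \<in> borel_measurable borel"
    and lim: "(g \<longlongrightarrow> g0) (at_right 0)"
  shows "(LINT x|lborel. indicator {0<..} x * (std_normal_density x * (x * g x))) =
     g0 / sqrt (2 * pi) + (LINT x|lborel. indicator {0<..} x * (std_normal_density x * g' x))"
proof -
  have "isCont std_normal_density 0"
    using DERIV_isCont[OF std_normal_density_has_real_derivative] .
  then have "(std_normal_density \<longlongrightarrow> std_normal_density 0) (at_right 0)"
    unfolding isCont_def by (rule filterlim_at_split[THEN iffD1, THEN conjunct2])
  from tendsto_mult[OF this lim]
  have "((\<lambda>x. std_normal_density x * g x) \<longlongrightarrow> g0 / sqrt (2 * pi)) (at_right 0)"
    by (simp add: std_normal_density_def)
  then show ?thesis
    using stein_interval[of "ereal 0" g g' C "g0 / sqrt (2 * pi)"] assms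
    by (simp add: ereal_tendsto_simps1)
qed

section \<open>Test functions and the Gaussian semigroup\<close>

text \<open>A linear map is determined by its values on the axes, and there the Frechet derivative
  is the directional derivative that defines \<open>partial_deriv\<close>.\<close>

lemma has_derivative_partial_derivs:
  fixes f :: "real^'n::finite \<Rightarrow> real"
  assumes "f differentiable (at x)"
  shows "(f has_derivative (\<lambda>h. \<Sum>j\<in>UNIV. h $ j * partial_deriv j f x)) (at x)"
proof -
  obtain D where D: "(f has_derivative D) (at x)"
    using assms by (auto simp: differentiable_def)
  have lin: "linear D" by (rule has_derivative_linear[OF D])
  have "D (axis j 1) = partial_deriv j f x" for j
  proof -
    have "((\<lambda>h::real. f (x + h *\<^sub>R axis j 1)) has_derivative (\<lambda>h. D (h *\<^sub>R axis j 1))) (at 0)"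
      by (rule has_derivative_compose[where f = "\<lambda>h::real. x + h *\<^sub>R axis j 1"])
        (auto intro!: derivative_eq_intros simp: D)
    then have "((\<lambda>h::real. f (x + h *\<^sub>R axis j 1)) has_real_derivative D (axis j 1)) (at 0)"
      unfolding has_field_derivative_def by (simp add: linear_cmul[OF lin] mult_commute_abs)
    then show ?thesis unfolding partial_deriv_def by (simp add: DERIV_imp_deriv)
  qed
  then have "D h = (\<Sum>j\<in>UNIV. h $ j * partial_deriv j f x)" for h
    by (subst basis_expansion[of h, symmetric])
      (simp only: scalar_mult_eq_scaleR linear_sum[OF lin] linear_cmul[OF lin] real_scaleR_def)
  then have "D = (\<lambda>h. \<Sum>j\<in>UNIV. h $ j * partial_deriv j f x)" by (rule ext)
  with D show ?thesis by simp
qed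

text \<open>Chain rule along a coordinate line run through at speed \<open>c\<close>. It supplies
  the derivative needed to apply the one-dimensional Stein identity in coordinate
  \<open>j\<close>.\<close>

lemma partial_deriv_line:
  fixes f :: "real^'n::finite \<Rightarrow> real"
  assumes "\<And>x. f differentiable (at x)"
  shows "((\<lambda>y. f (x + (c * y) *\<^sub>R axis j 1)) has_real_derivative
    c * partial_deriv j f (x + (c * y) *\<^sub>R axis j 1)) (at y)"
proof -
  have "((\<lambda>y. f (x + (c * y) *\<^sub>R axis j 1)) has_derivative
     (\<lambda>h. \<Sum>i\<in>UNIV. ((c * h) *\<^sub>R axis j 1) $ i * partial_deriv i f (x + (c * y) *\<^sub>R axis j 1))) (at y)"
    by (rule has_derivative_compose[OF _ has_derivative_partial_derivs[OF assms]])
      (auto intro!: derivative_eq_intros)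
  moreover have "(\<Sum>i\<in>UNIV. ((c * h) *\<^sub>R axis j 1 :: real^'n) $ i * p i) = c * p j * h" for h p
  proof -
    have "(\<Sum>i\<in>UNIV. ((c * h) *\<^sub>R axis j 1 :: real^'n) $ i * p i) = (\<Sum>i\<in>UNIV. if i = j then c * p j * h else 0)"
      by (rule sum.cong) (auto simp: axis_def)
    then show ?thesis by simp
  qed
  ultimately show ?thesis by (simp add: has_field_derivative_def)
qed

text \<open>Chain rule along the ray; the denominator comes from the derivative of
  \<open>sqrt\<close>, hence \<open>s > 0\<close>.\<close>

lemma has_real_derivative_radial:
  fixes f :: "real^'n::finite \<Rightarrow> real"
  assumes "\<And>x. f differentiable (at x)" "s > 0"
  shows "((\<lambda>s. f (sqrt s *\<^sub>R v)) has_real_derivative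
    (\<Sum>j\<in>UNIV. v $ j * partial_deriv j f (sqrt s *\<^sub>R v)) / (2 * sqrt s)) (at s)"
proof -
  have sq: "(sqrt has_derivative (\<lambda>h. h / (2 * sqrt s))) (at s)"
    using DERIV_real_sqrt[OF assms(2)] unfolding has_field_derivative_def
    by (rule has_derivative_eq_rhs) (simp add: fun_eq_iff field_simps)
  have "((\<lambda>s. f (sqrt s *\<^sub>R v)) has_derivative
     (\<lambda>h. \<Sum>j\<in>UNIV. ((h / (2 * sqrt s)) *\<^sub>R v) $ j * partial_deriv j f (sqrt s *\<^sub>R v))) (at s)"
    by (rule has_derivative_compose[OF _ has_derivative_partial_derivs[OF assms(1)]])
      (rule has_derivative_scaleR_left[OF sq])
  also have "(\<lambda>h. \<Sum>j\<in>UNIV. ((h / (2 * sqrt s)) *\<^sub>R v) $ j * partial_deriv j f (sqrt s *\<^sub>R v)) =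
     (\<lambda>h. (\<Sum>j\<in>UNIV. v $ j * partial_deriv j f (sqrt s *\<^sub>R v)) / (2 * sqrt s) * h)"
    unfolding sum_divide_distrib sum_distrib_right by (intro ext sum.cong) simp_all
  finally show ?thesis unfolding has_field_derivative_def .
qed

section \<open>Closure properties of smooth functions and test functions\<close>

lemma smooth_differentiable: "smooth f \<Longrightarrow> f differentiable (at x)"
  unfolding smooth_def by (metis foldr_Nil id_apply)

lemma smooth_partial_deriv:
  assumes "smooth f"
  shows "smooth (partial_deriv j f)"
  unfolding smooth_def
proof (intro allI)
  fix js x
  \<comment> \<open>\<open>foldr\<close> applies the last entry first, so the iterated derivatives
    of \<open>partial_deriv j f\<close> are those of \<open>f\<close> along lists ending in
    \<open>j\<close>.\<close>
  have "foldr partial_deriv (js @ [j]) f differentiable (at x)"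
    using assms unfolding smooth_def by blast
  then show "foldr partial_deriv js (partial_deriv j f) differentiable (at x)" by simp
qed

lemma partial_deriv_sum:
  assumes "\<And>k. k \<in> A \<Longrightarrow> f k differentiable (at x)"
  shows "partial_deriv j (\<lambda>x. \<Sum>k\<in>A. f k x) x = (\<Sum>k\<in>A. partial_deriv j (f k) x)"
proof -
  have "((\<lambda>h. f k (x + h *\<^sub>R axis j 1)) has_real_derivative partial_deriv j (f k) x) (at 0)"
    if "k \<in> A" for k
  proof -
    have "(\<lambda>h::real. f k (x + h *\<^sub>R axis j 1)) differentiable (at 0)"
      by (rule differentiable_compose[where g = "\<lambda>h::real. x + h *\<^sub>R axis j 1"])
        (auto intro!: derivative_intros simp: assms[OF that])
    then show ?thesis
      unfolding partial_deriv_def using real_differentiable_def DERIV_imp_deriv by metis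
  qed
  then have "((\<lambda>h. \<Sum>k\<in>A. f k (x + h *\<^sub>R axis j 1)) has_real_derivative
      (\<Sum>k\<in>A. partial_deriv j (f k) x)) (at 0)"
    by (rule DERIV_sum)
  then show ?thesis
    unfolding partial_deriv_def[of j "\<lambda>x. \<Sum>k\<in>A. f k x"] by (rule DERIV_imp_deriv)
qed

text \<open>By induction every iterated derivative passes through the sum; smoothness of the
  summands supplies at each stage the differentiability that \<open>partial_deriv_sum\<close> asks
  for.\<close>

lemma smooth_sum:
  assumes "finite A" "\<And>k. k \<in> A \<Longrightarrow> smooth (f k)"
  shows "smooth (\<lambda>x. \<Sum>k\<in>A. f k x)"
proof -
  have "foldr partial_deriv js (\<lambda>x. \<Sum>k\<in>A. f k x) = (\<lambda>x. \<Sum>k\<in>A. foldr partial_deriv js (f k) x)" for js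
  proof (induction js)
    case (Cons j js)
    show ?case
      using assms(2) by (auto simp: Cons smooth_def intro!: partial_deriv_sum)
  qed simp
  then show ?thesis
    using assms unfolding smooth_def by (auto intro!: differentiable_sum)
qed

text \<open>Off its closed support \<open>f\<close> vanishes on a whole neighbourhood, so its
  partial derivatives vanish there: differentiation does not enlarge the support.\<close>

lemma test_function_partial_deriv:
  assumes "test_function f"
  shows "test_function (partial_deriv j f)"
proof -
  let ?K = "closure {x. f x \<noteq> 0}"
  have "partial_deriv j f x = 0" if "x \<notin> ?K" for x
  proof -
    have "open (- ?K)" by auto
    moreover have "((\<lambda>h::real. x + h *\<^sub>R axis j 1) \<longlongrightarrow> x) (nhds 0)"
      by (auto intro!: tendsto_eq_intros filterlim_ident)
    ultimately have "\<forall>\<^sub>F h::real in nhds 0. x + h *\<^sub>R axis j 1 \<in> - ?K"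
      using that by (rule_tac topological_tendstoD) auto
    then have "\<forall>\<^sub>F h::real in nhds 0. f (x + h *\<^sub>R axis j 1) = 0"
      by eventually_elim (use closure_subset[of "{x. f x \<noteq> 0}"] in auto)
    then show ?thesis
      unfolding partial_deriv_def by (subst deriv_cong_ev[OF _ refl]) auto
  qed
  then have "{x. partial_deriv j f x \<noteq> 0} \<subseteq> ?K" by blast
  moreover have "bounded ?K"
    using assms compact_imp_bounded unfolding test_function_def by blast
  ultimately have "bounded {x. partial_deriv j f x \<noteq> 0}" by (rule bounded_subset[rotated])
  then show ?thesis
    using assms smooth_partial_deriv[of f j] unfolding test_function_def by simp
qed

text \<open>The set where the sum is nonzero lies in a finite union of bounded sets, and a bounded
  set has compact closure.\<close>

lemma test_function_sum:
  assumes A: "finite A" and f: "\<And>k. k \<in> A \<Longrightarrow> test_function (f k)"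
  shows "test_function (\<lambda>x. \<Sum>k\<in>A. f k x)"
proof -
  have "bounded {x. f k x \<noteq> 0}" if "k \<in> A" for k
    using f[OF that] unfolding test_function_def by simp
  then have "bounded (\<Union>k\<in>A. {x. f k x \<noteq> 0})"
    using A by (intro bounded_UN) auto
  moreover have "{x. (\<Sum>k\<in>A. f k x) \<noteq> 0} \<subseteq> (\<Union>k\<in>A. {x. f k x \<noteq> 0})"
    by (auto elim: sum.not_neutral_contains_not_neutral)
  ultimately have "bounded {x. (\<Sum>k\<in>A. f k x) \<noteq> 0}" by (rule bounded_subset)
  then show ?thesis
    using smooth_sum[OF A, of f] f unfolding test_function_def by simp
qed

lemma test_function_laplacian: "test_function f \<Longrightarrow> test_function (laplacian f)"
  unfolding laplacian_def[abs_def]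
  by (intro test_function_sum test_function_partial_deriv) auto

lemma test_function_differentiable: "test_function f \<Longrightarrow> f differentiable (at x)"
  by (simp add: test_function_def smooth_differentiable)

lemma test_function_continuous_on: "test_function f \<Longrightarrow> continuous_on S f"
  by (meson continuous_at_imp_continuous_on differentiable_imp_continuous_within
      test_function_differentiable)

lemma test_function_measurable: "test_function f \<Longrightarrow> f \<in> borel_measurable borel"
  by (intro borel_measurable_continuous_onI test_function_continuous_on)

lemma test_function_bounded:
  assumes "test_function f"
  obtains C where "\<And>x. \<bar>f x\<bar> \<le> C"
proof -
  let ?K = "closure {x. f x \<noteq> 0}"
  have "compact (f ` ?K)"
    using assms by (intro compact_continuous_image test_function_continuous_on)
      (simp_all add: test_function_def)
  from compact_imp_bounded[OF this] obtain C where C: "\<And>y. y \<in> f ` ?K \<Longrightarrow> \<bar>y\<bar> \<le> C"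
    unfolding bounded_iff real_norm_def by blast
  \<comment> \<open>\<open>C\<close> bounds the values on the support only, and may be negative if
    the support is empty; the maximum also covers the zeros of \<open>f\<close>.\<close>
  have "\<bar>f x\<bar> \<le> max C 0" for x
    using C[of "f x"] closure_subset[of "{x. f x \<noteq> 0}"] by (cases "f x = 0") fastforce+
  then show thesis by (rule that)
qed

section \<open>The standard normal vector and Stein's identity for it\<close>

text \<open>The law lives on functions rather than on \<open>real^'n\<close> so that Fubini and the
  independence criteria for \<open>Pi\<^sub>M\<close> apply; \<open>vec_lambda\<close> carries it
  over to vectors.\<close>

definition std_normal_vec :: "('n::finite \<Rightarrow> real) measure" where
  "std_normal_vec = Pi\<^sub>M UNIV (\<lambda>_. density lborel (\<lambda>x. ennreal (std_normal_density x)))"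

lemma prob_space_std_normal_vec: "prob_space std_normal_vec"
  unfolding std_normal_vec_def by (intro prob_space_PiM prob_space_normal_density) simp

text \<open>Measurability into a Euclidean space can be tested by inner products with the basis,
  that is, coordinate by coordinate.\<close>

lemma borel_measurable_vec_lambda:
  fixes X :: "'a \<Rightarrow> 'n::finite \<Rightarrow> real"
  assumes "\<And>j. (\<lambda>\<omega>. X \<omega> j) \<in> borel_measurable M"
  shows "(\<lambda>\<omega>. vec_lambda (X \<omega>)) \<in> borel_measurable M"
proof (subst borel_measurable_euclidean_space, rule ballI)
  fix i :: "real^'n" assume "i \<in> Basis"
  then obtain j where "i = axis j 1" by (auto simp: Basis_vec_def)
  then show "(\<lambda>\<omega>. vec_lambda (X \<omega>) \<bullet> i) \<in> borel_measurable M"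
    using assms[of j] by (simp add: inner_axis)
qed

lemma sets_std_normal_vec: "sets std_normal_vec = sets (Pi\<^sub>M UNIV (\<lambda>_. borel))"
  unfolding std_normal_vec_def by (intro sets_PiM_cong) auto

lemma measurable_scaled_std_normal_vec [measurable]:
  "(\<lambda>z. c *\<^sub>R vec_lambda z) \<in> borel_measurable (std_normal_vec :: ('n::finite \<Rightarrow> real) measure)"
proof -
  have "(\<lambda>z. vec_lambda z) \<in> borel_measurable (std_normal_vec :: ('n::finite \<Rightarrow> real) measure)"
    by (intro borel_measurable_vec_lambda) (simp add: measurable_cong_sets[OF sets_std_normal_vec refl])
  then show ?thesis by simp
qed

text \<open>Each marginal is standard normal and so has a finite first absolute moment.\<close>

lemma integrable_std_normal_vec_abs_component: "integrable std_normal_vec (\<lambda>z. \<bar>z j\<bar>)"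
proof -
  let ?n = "density lborel (\<lambda>x. ennreal (std_normal_density x))"
  have d: "distr std_normal_vec ?n (\<lambda>z. z j) = ?n"
    unfolding std_normal_vec_def by (rule distr_PiM_component) (auto intro: prob_space_normal_density)
  have "integrable ?n abs"
    by (subst integrable_real_density) (use integrable_std_normal_moment_abs[of 1] in auto)
  then have "integrable (distr std_normal_vec ?n (\<lambda>z. z j)) abs" by (simp add: d)
  then show ?thesis
    by (rule integrable_distr[rotated]) (auto simp: std_normal_vec_def)
qed

lemma integrable_std_normal_vec_bounded:
  fixes f :: "real^'n::finite \<Rightarrow> real"
  assumes [measurable]: "f \<in> borel_measurable borel" and "\<And>x. \<bar>f x\<bar> \<le> C"
  shows "integrable std_normal_vec (\<lambda>z. f (c *\<^sub>R vec_lambda z))"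
    and "integrable std_normal_vec (\<lambda>z. z j * f (c *\<^sub>R vec_lambda z))"
proof -
  interpret prob_space "std_normal_vec :: ('n \<Rightarrow> real) measure" by (rule prob_space_std_normal_vec)
  show "integrable std_normal_vec (\<lambda>z. f (c *\<^sub>R vec_lambda z))"
    by (rule integrable_const_bound[where B = C]) (use assms in auto)
  have [measurable]: "(\<lambda>z. z j) \<in> borel_measurable std_normal_vec"
    by (simp add: measurable_cong_sets[OF sets_std_normal_vec refl])
  show "integrable std_normal_vec (\<lambda>z. z j * f (c *\<^sub>R vec_lambda z))"
  proof (rule Bochner_Integration.integrable_bound)
    show "integrable std_normal_vec (\<lambda>z. \<bar>z j\<bar> * C)"
      using integrable_std_normal_vec_abs_component[of j] by simp
    have "\<bar>z j\<bar> * \<bar>f x\<bar> \<le> \<bar>z j\<bar> * \<bar>C\<bar>" for z :: "'n \<Rightarrow> real" and x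
      using assms(2)[of x] by (intro mult_left_mono) auto
    then show "AE z in std_normal_vec. norm (z j * f (c *\<^sub>R vec_lambda z)) \<le> norm (\<bar>z j\<bar> * C)"
      by (simp add: abs_mult)
  qed simp
qed

text \<open>Fubini integrates coordinate \<open>j\<close> first; with the others frozen this is the
  one-dimensional identity, and \<open>c\<close> is the speed of the coordinate line.\<close>

lemma stein_identity_vec:
  fixes f :: "real^'n::finite \<Rightarrow> real"
  assumes f: "test_function f"
  shows "(LINT z|std_normal_vec. z j * f (c *\<^sub>R vec_lambda z)) =
         c * (LINT z|std_normal_vec. partial_deriv j f (c *\<^sub>R vec_lambda z))"
proof -
  note df = test_function_partial_deriv[OF f, of j]
  have [measurable]: "f \<in> borel_measurable borel" "partial_deriv j f \<in> borel_measurable borel"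
    using f df by (auto intro: test_function_measurable)
  obtain C where C: "\<And>x. \<bar>f x\<bar> \<le> C" using test_function_bounded[OF f] by blast
  obtain C' where C': "\<And>x. \<bar>partial_deriv j f x\<bar> \<le> C'" using test_function_bounded[OF df] by blast
  let ?n = "density lborel (\<lambda>x. ennreal (std_normal_density x))"
  let ?R = "Pi\<^sub>M (UNIV - {j}) (\<lambda>_. ?n)"
  interpret product_sigma_finite "\<lambda>_::'n. ?n"
    by (intro product_sigma_finite.intro prob_space_imp_sigma_finite prob_space_normal_density) simp
  \<comment> \<open>Varying coordinate \<open>j\<close> moves the argument along a line parallel to
    an axis, in the form treated by \<open>partial_deriv_line\<close>.\<close>
  have upd: "c *\<^sub>R vec_lambda (x(j := y)) = (\<chi> i. if i = j then 0 else c * x i) + (c * y) *\<^sub>R axis j 1" for x y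
    by (simp add: vec_eq_iff axis_def)
  have fubini: "integral\<^sup>L std_normal_vec g = (LINT x|?R. LINT y|?n. g (x(j := y)))"
    if "integrable std_normal_vec g" for g :: "('n \<Rightarrow> real) \<Rightarrow> real"
    using product_integral_insert[of "UNIV - {j}" j g] that
    by (simp add: std_normal_vec_def insert_absorb insert_Diff)
  have dens: "(LINT y|?n. g y) = (LINT y|lborel. std_normal_density y * g y)"
    if "g \<in> borel_measurable borel" for g :: "real \<Rightarrow> real"
    using that by (simp add: integral_real_density)
  have inner: "(LINT y|?n. (x(j := y)) j * f (c *\<^sub>R vec_lambda (x(j := y)))) =
      (LINT y|?n. c * partial_deriv j f (c *\<^sub>R vec_lambda (x(j := y))))" for x
  proof -
    have m: "(\<lambda>y. a + (c * y) *\<^sub>R axis j 1) \<in> borel_measurable borel" for a :: "real^'n"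
      by (intro borel_measurable_continuous_onI continuous_intros)
    note [measurable] = measurable_compose[OF m, of f] measurable_compose[OF m, of "partial_deriv j f"]
    \<comment> \<open>\<open>stein_identity\<close> takes one constant for both the function and its
      derivative.\<close>
    define K where "K = max C (\<bar>c\<bar> * C')"
    have "\<bar>c\<bar> * \<bar>partial_deriv j f x\<bar> \<le> \<bar>c\<bar> * C'" for x
      using C'[of x] by (intro mult_left_mono) auto
    then have K: "\<bar>f x\<bar> \<le> K" "\<bar>c * partial_deriv j f x\<bar> \<le> K" for x
      using C[of x] by (auto simp: K_def abs_mult max.coboundedI1 max.coboundedI2)
    have "continuous_on UNIV (\<lambda>y. partial_deriv j f (a + (c * y) *\<^sub>R axis j 1))" for a
      by (rule continuous_on_compose2[OF test_function_continuous_on[OF df]])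
        (auto intro!: continuous_intros)
    then have "isCont (\<lambda>y. c * partial_deriv j f (a + (c * y) *\<^sub>R axis j 1)) y" for a y
      by (intro continuous_intros) (simp add: continuous_on_eq_continuous_at)
    from stein_identity[OF partial_deriv_line[OF test_function_differentiable[OF f]] this K]
    show ?thesis by (simp add: upd dens mult.left_commute[of _ c])
  qed
  show ?thesis
    using fubini[OF integrable_std_normal_vec_bounded(2)[of f C j c]]
      fubini[OF integrable_mult_right[of c, OF integrable_std_normal_vec_bounded(1)[of "partial_deriv j f" C' c]]]
      C C' inner by auto
qed

section \<open>The heat semigroup at the origin\<close>

text \<open>For \<open>s \<ge> 0\<close> this is the heat semigroup generated by half the Laplacian,
  applied to \<open>f\<close> and evaluated at the origin. The real \<open>sqrt\<close> is total and
  continuous, so \<open>heat f\<close> makes sense for every real \<open>s\<close>.\<close>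

definition heat :: "(real^'n::finite \<Rightarrow> real) \<Rightarrow> real \<Rightarrow> real" where
  "heat f s = (LINT z|std_normal_vec. f (sqrt s *\<^sub>R vec_lambda z))"

lemma heat_0:
  fixes f :: "real^'n::finite \<Rightarrow> real"
  shows "heat f 0 = f 0"
proof -
  interpret prob_space "std_normal_vec :: ('n \<Rightarrow> real) measure" by (rule prob_space_std_normal_vec)
  show ?thesis by (simp add: heat_def prob_space)
qed

lemma abs_heat_le:
  fixes f :: "real^'n::finite \<Rightarrow> real"
  assumes "f \<in> borel_measurable borel" "\<And>x. \<bar>f x\<bar> \<le> C"
  shows "\<bar>heat f s\<bar> \<le> C"
proof -
  interpret prob_space "std_normal_vec :: ('n \<Rightarrow> real) measure" by (rule prob_space_std_normal_vec)
  have "\<bar>heat f s\<bar> \<le> (LINT z|(std_normal_vec :: ('n \<Rightarrow> real) measure). \<bar>f (sqrt s *\<^sub>R vec_lambda z)\<bar>)"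
    unfolding heat_def by (rule integral_abs_bound)
  also have "\<dots> \<le> C"
    by (rule integral_le_const)
      (use integrable_std_normal_vec_bounded(1)[OF assms] assms(2) in auto)
  finally show ?thesis .
qed

lemma continuous_on_heat:
  fixes f :: "real^'n::finite \<Rightarrow> real"
  assumes "continuous_on UNIV f" "\<And>x. \<bar>f x\<bar> \<le> C"
  shows "continuous_on S (heat f)"
  unfolding continuous_on_sequentially
proof (intro ballI allI impI)
  interpret prob_space "std_normal_vec :: ('n \<Rightarrow> real) measure" by (rule prob_space_std_normal_vec)
  fix X :: "nat \<Rightarrow> real" and s assume X: "(\<forall>n. X n \<in> S) \<and> X \<longlonglongrightarrow> s"
  have [measurable]: "f \<in> borel_measurable borel"
    using assms(1) by (rule borel_measurable_continuous_onI)
  show "(heat f \<circ> X) \<longlonglongrightarrow> heat f s"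
    unfolding heat_def o_def
  proof (rule integral_dominated_convergence[where w = "\<lambda>_. C"])
    have "(\<lambda>n. f (sqrt (X n) *\<^sub>R v)) \<longlonglongrightarrow> f (sqrt s *\<^sub>R v)" for v
      using X by (intro continuous_on_tendsto_compose[OF assms(1)] tendsto_intros) auto
    then show "AE z in std_normal_vec. (\<lambda>n. f (sqrt (X n) *\<^sub>R vec_lambda z)) \<longlonglongrightarrow> f (sqrt s *\<^sub>R vec_lambda z)"
      by simp
  qed (use assms(2) in auto)
qed

text \<open>Radial differentiation produces factors \<open>z j / (2 * sqrt s)\<close>. Stein's
  identity trades each \<open>z j\<close> for \<open>sqrt s\<close> and a second derivative in the
  same variable; the roots cancel and half the Laplacian remains.\<close>

lemma heat_has_real_derivative:
  fixes f :: "real^'n::finite \<Rightarrow> real"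
  assumes f: "test_function f" and s: "s > 0"
  shows "(heat f has_real_derivative heat (laplacian f) s / 2) (at s)"
proof -
  note df = test_function_partial_deriv[OF f]
  note ddf = test_function_partial_deriv[OF df]
  have [measurable]: "f \<in> borel_measurable borel" "\<And>j. partial_deriv j f \<in> borel_measurable borel"
    using f df by (auto intro: test_function_measurable)
  obtain C where C: "\<And>x. \<bar>f x\<bar> \<le> C" using test_function_bounded[OF f] by blast
  have "\<exists>C. \<forall>x. \<bar>partial_deriv j f x\<bar> \<le> C" for j
    using test_function_bounded[OF df[of j]] by metis
  then obtain D where D: "\<And>j x. \<bar>partial_deriv j f x\<bar> \<le> D j" by metis
  have "\<exists>C. \<forall>x. \<bar>partial_deriv j (partial_deriv j f) x\<bar> \<le> C" for j
    using test_function_bounded[OF ddf[of j j]] by metis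
  then obtain D2 where D2: "\<And>j x. \<bar>partial_deriv j (partial_deriv j f) x\<bar> \<le> D2 j" by metis
  let ?f' = "\<lambda>s z. (\<Sum>j\<in>UNIV. z j * partial_deriv j f (sqrt s *\<^sub>R vec_lambda z)) / (2 * sqrt s)"
  have int1: "integrable std_normal_vec (\<lambda>z. z j * partial_deriv j f (c *\<^sub>R vec_lambda z))" for j c
    by (rule integrable_std_normal_vec_bounded) (use D in auto)
  have int2: "integrable std_normal_vec (\<lambda>z. partial_deriv j (partial_deriv j f) (c *\<^sub>R vec_lambda z))" for j c
    by (rule integrable_std_normal_vec_bounded) (use D2 test_function_measurable[OF ddf] in auto)
  have "(heat f has_real_derivative (LINT z|std_normal_vec. ?f' s z)) (at s)"
    unfolding heat_def[abs_def]
  \<comment> \<open>The left end \<open>s/2\<close> keeps the time away from 0, so that the factor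
    \<open>1 / (2 * sqrt r)\<close> is bounded uniformly.\<close>
  proof (rule has_real_derivative_integral[where a = "s/2" and b = "2 * s" and
        g = "\<lambda>z. (\<Sum>j\<in>(UNIV :: 'n set). \<bar>z j\<bar> * D j) / (2 * sqrt (s/2))"])
    show "integrable std_normal_vec (\<lambda>z. f (sqrt r *\<^sub>R vec_lambda z))" for r
      by (rule integrable_std_normal_vec_bounded) (use C in auto)
    show "((\<lambda>s. f (sqrt s *\<^sub>R vec_lambda z)) has_real_derivative ?f' r z) (at r)"
      if "r \<in> {s/2<..<2 * s}" for r z
      using has_real_derivative_radial[OF test_function_differentiable[OF f], of r "vec_lambda z"] that s
      by simp
    show "\<bar>?f' r z\<bar> \<le> (\<Sum>j\<in>UNIV. \<bar>z j\<bar> * D j) / (2 * sqrt (s/2))" if "r \<in> {s/2<..<2 * s}" for r z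
    proof -
      have "\<bar>\<Sum>j\<in>UNIV. z j * partial_deriv j f (sqrt r *\<^sub>R vec_lambda z)\<bar> \<le> (\<Sum>j\<in>UNIV. \<bar>z j\<bar> * D j)"
        using D by (intro order_trans[OF sum_abs] sum_mono) (simp add: abs_mult mult_left_mono)
      moreover have "0 < 2 * sqrt (s/2)" "2 * sqrt (s/2) \<le> 2 * sqrt r" using s that by auto
      ultimately show ?thesis
        by (subst abs_divide) (auto intro!: frac_le)
    qed
    show "?f' s \<in> borel_measurable std_normal_vec"
      using int1 by (intro borel_measurable_divide borel_measurable_sum) auto
    show "integrable std_normal_vec (\<lambda>z. (\<Sum>j\<in>UNIV. \<bar>z j\<bar> * D j) / (2 * sqrt (s/2)))"
      by (intro integrable_divide Bochner_Integration.integrable_sum integrable_mult_left) (rule integrable_std_normal_vec_abs_component)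
  qed (use s in auto)
  also have "(LINT z|std_normal_vec. ?f' s z) =
      (\<Sum>j\<in>UNIV. sqrt s * (LINT z|std_normal_vec. partial_deriv j (partial_deriv j f) (sqrt s *\<^sub>R vec_lambda z)))
        / (2 * sqrt s)"
    using int1 by (simp add: Bochner_Integration.integral_sum stein_identity_vec[OF df])
  also have "\<dots> = heat (laplacian f) s / 2"
    using s int2 by (simp add: heat_def laplacian_def Bochner_Integration.integral_sum
        flip: sum_distrib_left)
  finally show ?thesis .
qed

section \<open>Brownian motion at an independent random time\<close>

text \<open>A normal law is determined by its mean and variance, and a positive variance rules out
  the degenerate alternative.\<close>

lemma gaussian_rv_centered_distributed:
  assumes "prob_space M" "gaussian_rv M X"
    and mean: "(LINT \<omega>|M. X \<omega>) = 0" and var: "(LINT \<omega>|M. X \<omega> * X \<omega>) = v\<^sup>2" and v: "v > 0"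
  shows "distributed M lborel X (\<lambda>x. ennreal (normal_density 0 v x))"
proof -
  interpret prob_space M by fact
  obtain \<mu> \<sigma> where X: "X \<in> borel_measurable M" and
    cases: "(\<sigma> > 0 \<and> distributed M lborel X (\<lambda>x. ennreal (normal_density \<mu> \<sigma> x))) \<or>
            (\<sigma> = 0 \<and> (AE \<omega> in M. X \<omega> = \<mu>))"
    using assms(2) unfolding gaussian_rv_def by blast
  from cases show ?thesis
  proof
    assume *: "\<sigma> > 0 \<and> distributed M lborel X (\<lambda>x. ennreal (normal_density \<mu> \<sigma> x))"
    then have "\<mu> = 0" using normal_distributed_expectation[of \<sigma> X \<mu>] mean by simp
    moreover have "\<sigma>\<^sup>2 = v\<^sup>2"
      using normal_distributed_variance[of \<sigma> X \<mu>] * mean var by (simp add: power2_eq_square)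
    ultimately show ?thesis using * v by (simp add: power2_eq_iff)
  next
    assume *: "\<sigma> = 0 \<and> (AE \<omega> in M. X \<omega> = \<mu>)"
    then have AE: "AE \<omega> in M. X \<omega> = \<mu>" by simp
    have "(LINT \<omega>|M. X \<omega>) = (LINT \<omega>|M. \<mu>)"
      using X AE by (intro integral_cong_AE) auto
    then have "\<mu> = 0" using mean by (simp add: prob_space)
    then have "(LINT \<omega>|M. X \<omega> * X \<omega>) = (LINT \<omega>|M. 0)"
      using X AE by (intro integral_cong_AE) auto
    then show ?thesis using var v by simp
  qed
qed

text \<open>Evaluations and increments at fixed times are measurable on path space with the product
  sigma-algebra, so independence of the paths passes to them. Increments from time 0 are taken
  because \<open>B j 0\<close> vanishes only almost surely.\<close>

lemma independent_processes_increments: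
  assumes "prob_space M" "independent_processes M B Y" "s \<ge> 0" "t \<ge> 0"
  shows "prob_space.indep_vars M (\<lambda>_. borel)
    (\<lambda>k \<omega>. case k of None \<Rightarrow> Y t \<omega> | Some j \<Rightarrow> B j s \<omega> - B j 0 \<omega>) UNIV"
proof -
  interpret prob_space M by fact
  have "indep_vars (\<lambda>_. borel)
    (\<lambda>k \<omega>. (case k of None \<Rightarrow> (\<lambda>p. p t) | Some j \<Rightarrow> (\<lambda>p. p s - p 0))
       (\<lambda>t\<in>{0..}. case k of None \<Rightarrow> Y t \<omega> | Some j \<Rightarrow> B j t \<omega>)) UNIV"
    using assms(2)[unfolded independent_processes_def]
  proof (rule indep_vars_compose2)
    fix k :: "'b option"
    show "(case k of None \<Rightarrow> (\<lambda>p. p t) | Some j \<Rightarrow> (\<lambda>p. p s - p 0))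
        \<in> borel_measurable (Pi\<^sub>M {0..} (\<lambda>_. borel :: real measure))"
      using assms(3,4) by (auto split: option.split)
  qed
  moreover have "(\<lambda>k \<omega>. (case k of None \<Rightarrow> (\<lambda>p. p t) | Some j \<Rightarrow> (\<lambda>p. p s - p 0))
       (\<lambda>t\<in>{0..}. case k of None \<Rightarrow> Y t \<omega> | Some j \<Rightarrow> B j t \<omega>)) =
    (\<lambda>k \<omega>. case k of None \<Rightarrow> Y t \<omega> | Some j \<Rightarrow> B j s \<omega> - B j 0 \<omega>)"
    using assms(3,4) by (auto simp: fun_eq_iff split: option.split)
  ultimately show ?thesis by simp
qed

lemma distr_indep_std_normal:
  fixes X :: "'n::finite \<Rightarrow> 'w \<Rightarrow> real"
  assumes "prob_space M" "prob_space.indep_vars M (\<lambda>_. borel) X UNIV"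
    and X: "\<And>j. distributed M lborel (X j) (\<lambda>x. ennreal (std_normal_density x))"
  shows "distr M (Pi\<^sub>M UNIV (\<lambda>_. borel)) (\<lambda>\<omega> j. X j \<omega>) = std_normal_vec"
proof -
  interpret prob_space M by fact
  have [measurable]: "X j \<in> borel_measurable M" for j
    using distributed_measurable[OF X] by simp
  have "distr M borel (X j) = density lborel (\<lambda>x. ennreal (std_normal_density x))" for j
    using distributed_distr_eq_density[OF X] by (simp cong: distr_cong)
  then show ?thesis
    using assms(2) indep_vars_iff_distr_eq_PiM[where I = UNIV and M' = "\<lambda>_. borel" and X = X]
    by (simp add: std_normal_vec_def restrict_UNIV)
qed

text \<open>By Brownian scaling the increment over the time span \<open>s\<close> is
  \<open>sqrt s\<close> times a standard normal vector.\<close>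

lemma expectation_brownian_vec:
  fixes B :: "'n::finite \<Rightarrow> real \<Rightarrow> 'w \<Rightarrow> real" and f :: "real^'n \<Rightarrow> real"
  assumes M: "prob_space M" and B: "\<And>j. standard_brownian_motion M (B j)"
    and ind: "prob_space.indep_vars M (\<lambda>_. borel) (\<lambda>j \<omega>. B j s \<omega> - B j 0 \<omega>) UNIV"
    and f [measurable]: "f \<in> borel_measurable borel" and s: "s \<ge> 0"
  shows "(LINT \<omega>|M. f (\<chi> j. B j s \<omega> - B j 0 \<omega>)) = heat f s"
proof (cases "s = 0")
  \<comment> \<open>At time 0 the increment is identically 0 and has no density, so scaling is
    replaced by direct evaluation.\<close>
  case True
  interpret prob_space M by fact
  have "(\<chi> j. 0) = (0 :: real^'n)" by (simp add: vec_eq_iff)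
  then show ?thesis by (simp add: True heat_0 prob_space)
next
  case False
  with s have s: "s > 0" by simp
  interpret prob_space M by fact
  let ?X = "\<lambda>j \<omega>. (B j s \<omega> - B j 0 \<omega>) / sqrt s"
  have X: "distributed M lborel (?X j) (\<lambda>x. ennreal (std_normal_density x))" for j
  proof -
    have "distributed M lborel (\<lambda>\<omega>. B j s \<omega> - B j 0 \<omega>) (\<lambda>x. ennreal (normal_density 0 (sqrt (s - 0)) x))"
      using B[of j] s unfolding standard_brownian_motion_def by blast
    then have "distributed M lborel (\<lambda>\<omega>. (B j s \<omega> - B j 0 \<omega> - 0) / sqrt (s - 0))
        (\<lambda>x. ennreal (std_normal_density x))"
      by (rule normal_standard_normal_convert[THEN iffD1, rotated]) (use s in simp)
    then show ?thesis by simp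
  qed
  have [measurable]: "(\<lambda>\<omega>. ?X j \<omega>) \<in> borel_measurable M" for j
    using distributed_measurable[OF X] by simp
  have "indep_vars (\<lambda>_. borel) ?X UNIV"
    by (rule indep_vars_compose2[OF ind]) simp
  then have d: "distr M (Pi\<^sub>M UNIV (\<lambda>_. borel)) (\<lambda>\<omega> j. ?X j \<omega>) = std_normal_vec"
    by (rule distr_indep_std_normal[OF M _ X])
  have "heat f s = (LINT z|distr M (Pi\<^sub>M UNIV (\<lambda>_. borel)) (\<lambda>\<omega> j. ?X j \<omega>). f (sqrt s *\<^sub>R vec_lambda z))"
    by (simp add: heat_def d)
  also have "\<dots> = (LINT \<omega>|M. f (sqrt s *\<^sub>R (\<chi> j. ?X j \<omega>)))"
  proof (rule integral_distr)
    show "(\<lambda>\<omega> j. ?X j \<omega>) \<in> M \<rightarrow>\<^sub>M Pi\<^sub>M UNIV (\<lambda>_. borel)"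
      by (rule measurable_PiM_single') auto
    show "(\<lambda>z. f (sqrt s *\<^sub>R vec_lambda z)) \<in> borel_measurable (Pi\<^sub>M UNIV (\<lambda>_. borel))"
      by (subst measurable_cong_sets[OF sets_std_normal_vec[symmetric] refl]) measurable
  qed
  also have "\<dots> = (LINT \<omega>|M. f (\<chi> j. B j s \<omega> - B j 0 \<omega>))"
  proof -
    have "sqrt s *\<^sub>R (\<chi> j. ?X j \<omega>) = (\<chi> j. B j s \<omega> - B j 0 \<omega>)" for \<omega>
      using s by (simp add: vec_eq_iff)
    then show ?thesis by simp
  qed
  finally show ?thesis ..
qed

text \<open>The event that \<open>Y t\<close> lies in \<open>A\<close> is independent of the whole
  vector of increments, so the expectation of the product factors.\<close>

lemma expectation_brownian_vec_indicator:
  fixes B :: "'n::finite \<Rightarrow> real \<Rightarrow> 'w \<Rightarrow> real" and f :: "real^'n \<Rightarrow> real"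
  assumes M: "prob_space M" and B: "\<And>j. standard_brownian_motion M (B j)"
    and ind: "independent_processes M B Y"
    and f [measurable]: "f \<in> borel_measurable borel" and C: "\<And>x. \<bar>f x\<bar> \<le> C"
    and A [measurable]: "A \<in> sets borel" and s: "s \<ge> 0" and t: "t \<ge> 0"
  shows "(LINT \<omega>|M. indicator A (Y t \<omega>) * f (\<chi> j. B j s \<omega> - B j 0 \<omega>)) =
         (LINT \<omega>|M. indicator A (Y t \<omega>)) * heat f s"
proof -
  interpret prob_space M by fact
  let ?Z = "\<lambda>k \<omega>. case k of None \<Rightarrow> Y t \<omega> | Some j \<Rightarrow> B j s \<omega> - B j 0 \<omega>"
  have Z: "indep_vars (\<lambda>_. borel) ?Z UNIV"
    by (rule independent_processes_increments[OF M ind s t])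
  have rv [measurable]: "?Z k \<in> borel_measurable M" for k
    using Z unfolding indep_vars_def by blast
  have [measurable]: "Y t \<in> borel_measurable M" "(\<lambda>\<omega>. B j s \<omega> - B j 0 \<omega>) \<in> borel_measurable M" for j
    using rv[of None] rv[of "Some j"] by simp_all
  \<comment> \<open>Singleton blocks re-index the family from \<open>'n option\<close> to
    \<open>'n\<close>, leaving the increments alone.\<close>
  have "indep_vars (\<lambda>j. Pi\<^sub>M {Some j} (\<lambda>_. borel)) (\<lambda>j \<omega>. restrict (\<lambda>i. ?Z i \<omega>) {Some j}) UNIV"
    by (rule indep_vars_restrict[OF Z]) (auto simp: disjoint_family_on_def)
  then have "indep_vars (\<lambda>_. borel) (\<lambda>j \<omega>. (restrict (\<lambda>i. ?Z i \<omega>) {Some j}) (Some j)) UNIV"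
    by (rule indep_vars_compose2) simp
  then have ind': "indep_vars (\<lambda>_. borel) (\<lambda>j \<omega>. B j s \<omega> - B j 0 \<omega>) UNIV" by simp
  \<comment> \<open>Splitting the indices into the blocks \<open>{None}\<close> and
    \<open>range Some\<close> separates \<open>Y t\<close> from all increments jointly.\<close>
  have "indep_var (Pi\<^sub>M {None} (\<lambda>_. borel)) (\<lambda>\<omega>. restrict (\<lambda>i. ?Z i \<omega>) {None})
      (Pi\<^sub>M (range Some) (\<lambda>_. borel)) (\<lambda>\<omega>. restrict (\<lambda>i. ?Z i \<omega>) (range Some))"
    by (rule indep_var_restrict[OF Z]) auto
  moreover have "(\<lambda>p. indicator A (p None) :: real) \<in> borel_measurable (Pi\<^sub>M {None} (\<lambda>_. borel))"
    by measurable
  moreover have "(\<lambda>p. f (\<chi> j. p (Some j))) \<in> borel_measurable (Pi\<^sub>M (range Some) (\<lambda>_. borel))"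
    by (rule measurable_compose[OF borel_measurable_vec_lambda f]) simp
  ultimately have "indep_var borel ((\<lambda>p. indicator A (p None) :: real) \<circ> (\<lambda>\<omega>. restrict (\<lambda>i. ?Z i \<omega>) {None}))
      borel ((\<lambda>p. f (\<chi> j. p (Some j))) \<circ> (\<lambda>\<omega>. restrict (\<lambda>i. ?Z i \<omega>) (range Some)))"
    by (rule indep_var_compose)
  then have iv: "indep_var borel (\<lambda>\<omega>. indicator A (Y t \<omega>) :: real)
      borel (\<lambda>\<omega>. f (\<chi> j. B j s \<omega> - B j 0 \<omega>))"
    by (simp add: o_def)
  have "integrable M (\<lambda>\<omega>. indicator A (Y t \<omega>) :: real)"
    by (rule integrable_const_bound[where B = 1]) (auto simp: indicator_def)
  moreover have "integrable M (\<lambda>\<omega>. f (\<chi> j. B j s \<omega> - B j 0 \<omega>))"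
  proof (rule integrable_const_bound[where B = C])
    show "(\<lambda>\<omega>. f (\<chi> j. B j s \<omega> - B j 0 \<omega>)) \<in> borel_measurable M"
      by (rule measurable_compose[OF borel_measurable_vec_lambda f]) measurable
  qed (use C in auto)
  ultimately show ?thesis
    using indep_var_lebesgue_integral[OF iv] expectation_brownian_vec[OF M B ind' f s] by simp
qed

section \<open>Rounding a random time to a finite grid\<close>

text \<open>For \<open>m > 0\<close> and \<open>y \<ge> 0\<close>, the index of the last point of
  mesh \<open>1/m\<close> not beyond \<open>y\<close>. The cap \<open>m * m\<close> confines the
  grid to times up to \<open>m\<close>, so only finitely many values occur.\<close>

definition grid_floor :: "nat \<Rightarrow> real \<Rightarrow> nat" where
  "grid_floor m y = min (nat \<lfloor>real m * y\<rfloor>) (m * m)"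

lemma grid_floor_le: "grid_floor m y \<le> m * m"
  by (simp add: grid_floor_def)

lemma measurable_grid_floor [measurable]: "grid_floor m \<in> borel \<rightarrow>\<^sub>M count_space UNIV"
  unfolding grid_floor_def[abs_def] by measurable

lemma grid_floor_tendsto:
  assumes "y \<ge> 0"
  shows "(\<lambda>m. real (grid_floor m y) / real m) \<longlonglongrightarrow> y"
proof (rule tendsto_sandwich)
  show "\<forall>\<^sub>F m in sequentially. y - 1 / real m \<le> real (grid_floor m y) / real m"
  \<comment> \<open>From this index on \<open>m\<close> is positive and at least \<open>y\<close>,
    so the cap no longer lowers the value by more than the rounding does.\<close>
  proof (rule eventually_sequentiallyI[of "Suc (nat \<lceil>y\<rceil>)"])
    fix m assume "Suc (nat \<lceil>y\<rceil>) \<le> m"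
    then have m: "m > 0" "y \<le> real m" by linarith+
    then have "real m * y \<le> real (m * m)" by (simp add: mult_left_mono)
    moreover have "real m * y - 1 \<le> real (nat \<lfloor>real m * y\<rfloor>)" by linarith
    ultimately have "real m * y - 1 \<le> real (grid_floor m y)"
      unfolding grid_floor_def by (simp add: min_def)
    then have "(real m * y - 1) / real m \<le> real (grid_floor m y) / real m"
      by (rule divide_right_mono) simp
    then show "y - 1 / real m \<le> real (grid_floor m y) / real m"
      using m by (simp add: diff_divide_distrib)
  qed
  have "real (grid_floor m y) \<le> real m * y" for m
  proof -
    have "real (nat \<lfloor>real m * y\<rfloor>) \<le> real m * y" using assms by (simp add: of_nat_nat)
    then show ?thesis unfolding grid_floor_def by linarith
  qed
  then show "\<forall>\<^sub>F m in sequentially. real (grid_floor m y) / real m \<le> y"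
    using assms by (intro always_eventually allI) (auto simp: divide_simps mult.commute)
  show "(\<lambda>m. y - 1 / real m) \<longlonglongrightarrow> y"
    using tendsto_diff[OF tendsto_const lim_1_over_n] by simp
qed simp

text \<open>Path continuity is what makes the random time harmless: the time is rounded down to a finite
  grid, where independence applies to one grid point at a time, and then the mesh tends to \<open>0\<close>.\<close>
lemma expectation_brownian_vec_random_time:
  fixes B :: "'n::finite \<Rightarrow> real \<Rightarrow> 'w \<Rightarrow> real" and f :: "real^'n \<Rightarrow> real"
  assumes M: "prob_space M" and B: "\<And>j. standard_brownian_motion M (B j)"
    and ind: "independent_processes M B Y"
    and cont: "continuous_on UNIV f" and C: "\<And>x. \<bar>f x\<bar> \<le> C" and t: "t \<ge> 0"
    and Y [measurable]: "Y t \<in> borel_measurable M"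
    and X: "(\<lambda>\<omega>. \<chi> j. B j \<bar>Y t \<omega>\<bar> \<omega>) \<in> borel_measurable M"
  shows "(LINT \<omega>|M. f (\<chi> j. B j \<bar>Y t \<omega>\<bar> \<omega>)) = (LINT \<omega>|M. heat f \<bar>Y t \<omega>\<bar>)"
proof -
  interpret prob_space M by fact
  have f [measurable]: "f \<in> borel_measurable borel"
    using cont by (rule borel_measurable_continuous_onI)
  have [measurable]: "B j s \<in> borel_measurable M" if "s \<ge> 0" for j s
    using B[of j] that unfolding standard_brownian_motion_def by blast
  let ?T = "\<lambda>m \<omega>. real (grid_floor m \<bar>Y t \<omega>\<bar>) / real m"
  let ?W = "\<lambda>s \<omega>. \<chi> j. B j s \<omega> - B j 0 \<omega>"
  let ?A = "\<lambda>m k. {y::real. grid_floor m \<bar>y\<bar> = k}"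
  have A [measurable]: "?A m k \<in> sets borel" for m k by measurable
  have W: "(\<lambda>\<omega>. f (?W s \<omega>)) \<in> borel_measurable M" if "s \<ge> 0" for s
    by (rule measurable_compose[OF borel_measurable_vec_lambda f]) (use that in measurable)
  \<comment> \<open>Exactly one of the events \<open>?A m k\<close> with \<open>k \<le> m*m\<close>
    occurs, and on it the rounded time is the constant \<open>k / m\<close>.\<close>
  have split: "h (?T m \<omega>) = (\<Sum>k\<le>m*m. indicator (?A m k) (Y t \<omega>) * h (real k / real m))"
    for m \<omega> and h :: "real \<Rightarrow> real"
  proof -
    have "(\<Sum>k\<le>m*m. indicator (?A m k) (Y t \<omega>) * h (real k / real m)) =
        (\<Sum>k\<le>m*m. if grid_floor m \<bar>Y t \<omega>\<bar> = k then h (real k / real m) else 0)"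
      by (intro sum.cong) auto
    then show ?thesis using grid_floor_le[of m "\<bar>Y t \<omega>\<bar>"] by simp
  qed
  have splitW: "f (?W (?T m \<omega>) \<omega>) = (\<Sum>k\<le>m*m. indicator (?A m k) (Y t \<omega>) * f (?W (real k / real m) \<omega>))"
    for m \<omega> by (rule split[of "\<lambda>s. f (?W s \<omega>)"])
  have grid: "(LINT \<omega>|M. f (?W (?T m \<omega>) \<omega>)) = (LINT \<omega>|M. heat f (?T m \<omega>))" for m
  proof -
    have int: "integrable M (\<lambda>\<omega>. indicator (?A m k) (Y t \<omega>) * f (?W (real k / real m) \<omega>))" for k
    proof (rule integrable_const_bound[where B = "C"])
      show "(\<lambda>\<omega>. indicator (?A m k) (Y t \<omega>) * f (?W (real k / real m) \<omega>)) \<in> borel_measurable M"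
        using W[of "real k / real m"] by measurable
      have "0 \<le> C" using C[of 0] by linarith
      then show "AE \<omega> in M. norm (indicator (?A m k) (Y t \<omega>) * f (?W (real k / real m) \<omega>)) \<le> C"
        using C by (auto simp: indicator_def)
    qed
    have int': "integrable M (\<lambda>\<omega>. indicator (?A m k) (Y t \<omega>) * heat f (real k / real m))" for k
      by (rule integrable_const_bound[where B = "\<bar>heat f (real k / real m)\<bar>"]) (auto simp: indicator_def)
    have "(LINT \<omega>|M. indicator (?A m k) (Y t \<omega>) * f (?W (real k / real m) \<omega>)) =
        (LINT \<omega>|M. indicator (?A m k) (Y t \<omega>) * heat f (real k / real m))" for k
      using expectation_brownian_vec_indicator[OF M B ind f C A _ t, of "real k / real m" m k] by simp
    then show ?thesis
      unfolding splitW split[of "heat f"]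
      by (subst (1 2) Bochner_Integration.integral_sum) (use int int' in auto)
  qed
  \<comment> \<open>Finitely many coordinates share one null set. Off it the paths are continuous
    and start at 0, so the increments are the values themselves.\<close>
  have "AE \<omega> in M. \<forall>j\<in>UNIV. B j 0 \<omega> = 0 \<and> continuous_on {0..} (\<lambda>s. B j s \<omega>)"
    using B unfolding standard_brownian_motion_def by (intro AE_finite_allI AE_conjI) auto
  then have AE_lim: "AE \<omega> in M. (\<lambda>m. f (?W (?T m \<omega>) \<omega>)) \<longlonglongrightarrow> f (\<chi> j. B j \<bar>Y t \<omega>\<bar> \<omega>)"
  proof eventually_elim
    case (elim \<omega>)
    have "(\<lambda>m. B j (?T m \<omega>) \<omega>) \<longlonglongrightarrow> B j \<bar>Y t \<omega>\<bar> \<omega>" for j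
      using elim by (intro continuous_on_tendsto_compose[of "{0..}" "\<lambda>s. B j s \<omega>"] grid_floor_tendsto) auto
    then have "(\<lambda>m. \<chi> j. B j (?T m \<omega>) \<omega>) \<longlonglongrightarrow> (\<chi> j. B j \<bar>Y t \<omega>\<bar> \<omega>)"
      by (rule tendsto_vec_lambda)
    then show ?case
      using elim by (intro continuous_on_tendsto_compose[OF cont]) auto
  qed
  have "(\<lambda>m. LINT \<omega>|M. f (?W (?T m \<omega>) \<omega>)) \<longlonglongrightarrow> (LINT \<omega>|M. f (\<chi> j. B j \<bar>Y t \<omega>\<bar> \<omega>))"
  proof (rule integral_dominated_convergence[where w = "\<lambda>_. C"])
    show "(\<lambda>\<omega>. f (\<chi> j. B j \<bar>Y t \<omega>\<bar> \<omega>)) \<in> borel_measurable M"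
      by (rule measurable_compose[OF X f])
    show "(\<lambda>\<omega>. f (?W (?T m \<omega>) \<omega>)) \<in> borel_measurable M" for m
      unfolding splitW using W by (intro borel_measurable_sum borel_measurable_times) auto
  qed (use AE_lim C in auto)
  \<comment> \<open>On this side it is the continuity of \<open>heat f\<close> that lets the mesh
    tend to 0.\<close>
  moreover have "(\<lambda>m. LINT \<omega>|M. heat f (?T m \<omega>)) \<longlonglongrightarrow> (LINT \<omega>|M. heat f \<bar>Y t \<omega>\<bar>)"
  proof (rule integral_dominated_convergence[where w = "\<lambda>_. C"])
    have [measurable]: "heat f \<in> borel_measurable borel"
      by (rule borel_measurable_continuous_onI[OF continuous_on_heat[OF cont C]])
    show "(\<lambda>\<omega>. heat f (?T m \<omega>)) \<in> borel_measurable M" for m by measurable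
    show "(\<lambda>\<omega>. heat f \<bar>Y t \<omega>\<bar>) \<in> borel_measurable M" by measurable
    show "AE \<omega> in M. (\<lambda>m. heat f (?T m \<omega>)) \<longlonglongrightarrow> heat f \<bar>Y t \<omega>\<bar>"
      by (intro AE_I2 continuous_on_tendsto_compose[OF continuous_on_heat[OF cont C, of UNIV]] grid_floor_tendsto) auto
  qed (use abs_heat_le[OF f C] in auto)
  ultimately show ?thesis
    unfolding grid using LIMSEQ_unique by blast
qed

section \<open>The equation for the density\<close>

text \<open>The integrand is even, and the point 0, which separates the open from the closed
  half-line, is a null set. The open one is kept because \<open>heat\<close> is differentiated at
  positive times.\<close>

lemma integral_std_normal_even:
  fixes g :: "real \<Rightarrow> real"
  assumes [measurable]: "g \<in> borel_measurable borel" and C: "\<And>x. \<bar>g x\<bar> \<le> C"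
  shows "(LINT z|lborel. std_normal_density z * g \<bar>z\<bar>) =
     2 * (LINT z|lborel. indicator {0<..} z * (std_normal_density z * g z))"
proof -
  let ?I = "LINT z|lborel. indicator {0<..} z * (std_normal_density z * g z)"
  have "integrable lborel (\<lambda>z. indicator {0<..} z * (std_normal_density z * g z))"
    using integrable_mult_indicator[OF _ integrable_std_normal_times_bounded[of g C 0], of "{0<..}"] C
    by simp
  then have "has_bochner_integral lborel (\<lambda>z. indicator {0<..} z * (std_normal_density z * g z)) ?I"
    by (rule has_bochner_integral_integrable)
  moreover have "AE z in lborel. z \<noteq> (0::real)" by (rule AE_lborel_singleton)
  then have "AE z in lborel. indicator {0<..} z * (std_normal_density z * g z) =
      indicator {0..} z *\<^sub>R (std_normal_density z * g \<bar>z\<bar>)"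
    by eventually_elim (auto simp: indicator_def)
  ultimately have "has_bochner_integral lborel (\<lambda>z. indicator {0..} z *\<^sub>R (std_normal_density z * g \<bar>z\<bar>)) ?I"
    by (subst has_bochner_integral_cong_AE[symmetric]) auto
  then have "has_bochner_integral lborel (\<lambda>z. std_normal_density z * g \<bar>z\<bar>) (2 *\<^sub>R ?I)"
    by (rule has_bochner_integral_even_function) (simp add: std_normal_density_def)
  from has_bochner_integral_integral_eq[OF this] show ?thesis by simp
qed

text \<open>Write \<open>X\<close> as \<open>v\<close> times a standard normal variable and fold its
  law onto the half-line.\<close>

lemma expectation_abs_normal:
  fixes g :: "real \<Rightarrow> real"
  assumes M: "prob_space M" and X: "distributed M lborel X (\<lambda>x. ennreal (normal_density 0 v x))"
    and v: "v > 0" and g [measurable]: "g \<in> borel_measurable borel" and C: "\<And>x. \<bar>g x\<bar> \<le> C"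
  shows "(LINT \<omega>|M. g \<bar>X \<omega>\<bar>) =
     2 * (LINT z|lborel. indicator {0<..} z * (std_normal_density z * g (v * z)))"
proof -
  interpret prob_space M by fact
  have "distributed M lborel (\<lambda>\<omega>. (X \<omega> - 0) / v) (\<lambda>x. ennreal (std_normal_density x))"
    by (rule normal_standard_normal_convert[THEN iffD1, OF v X])
  from distributed_integral[OF this, of "\<lambda>z. g (v * \<bar>z\<bar>)"]
  have "(LINT \<omega>|M. g \<bar>X \<omega>\<bar>) = (LINT z|lborel. std_normal_density z * g (v * \<bar>z\<bar>))"
    using v by simp
  then show ?thesis
    using integral_std_normal_even[of "\<lambda>z. g (v * z)" C] C by simp
qed

text \<open>The Laplacian at the origin is the boundary term of Gaussian integration by parts on
  the half-line \<open>z > 0\<close>.\<close>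
lemma has_real_derivative_heat_abs_normal:
  fixes f :: "real^'n::finite \<Rightarrow> real"
  assumes f: "test_function f" and t: "t > 0"
  shows "((\<lambda>s. 2 * (LINT z|lborel. indicator {0<..} z * (std_normal_density z * heat f (s powr H * z))))
    has_real_derivative
      H * t powr (H - 1) / sqrt (2 * pi) * laplacian f 0 + H * t powr (2*H - 1) / 2^2 *
       (2 * (LINT z|lborel. indicator {0<..} z *
          (std_normal_density z * heat (laplacian (laplacian f)) (t powr H * z))))) (at t)"
proof -
  note lf = test_function_laplacian[OF f] and llf = test_function_laplacian[OF test_function_laplacian[OF f]]
  obtain C where C: "\<And>x. \<bar>f x\<bar> \<le> C" using test_function_bounded[OF f] by blast
  obtain C1 where C1: "\<And>x. \<bar>laplacian f x\<bar> \<le> C1" using test_function_bounded[OF lf] by blast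
  obtain C2 where C2: "\<And>x. \<bar>laplacian (laplacian f) x\<bar> \<le> C2" using test_function_bounded[OF llf] by blast
  note c = test_function_continuous_on[where S = UNIV]
  note hc = continuous_on_heat[OF c[OF f] C] continuous_on_heat[OF c[OF lf] C1]
    continuous_on_heat[OF c[OF llf] C2]
  note hb = abs_heat_le[OF test_function_measurable[OF f] C]
    abs_heat_le[OF test_function_measurable[OF lf] C1]
    abs_heat_le[OF test_function_measurable[OF llf] C2]
  have [measurable]: "heat f \<in> borel_measurable borel" "heat (laplacian f) \<in> borel_measurable borel"
    "heat (laplacian (laplacian f)) \<in> borel_measurable borel"
    using hc by (auto intro: borel_measurable_continuous_onI)
  let ?n = std_normal_density and ?I = "indicator {0<..} :: real \<Rightarrow> real"
  \<comment> \<open>\<open>?c\<close> is the derivative of \<open>s powr H\<close>. The factor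
    \<open>z\<close> produced by the chain rule is kept separate in \<open>?f'\<close>, which is
    then the left side of Stein's identity on the half-line.\<close>
  let ?c = "\<lambda>s. H * s powr (H - 1)"
  let ?f' = "\<lambda>s z. ?I z * (?n z * (z * (?c s / 2 * heat (laplacian f) (s powr H * z))))"
  \<comment> \<open>A power is monotone, so its value inside the interval is at most the sum of its
    values at the two ends, whatever the sign of \<open>H - 1\<close>.\<close>
  define K where "K = \<bar>H\<bar> * ((t/2) powr (H - 1) + (2 * t) powr (H - 1))"
  have K: "\<bar>?c s\<bar> \<le> K" if "s \<in> {t/2<..<2 * t}" for s
  proof -
    have "s powr (H - 1) \<le> (t/2) powr (H - 1) + (2 * t) powr (H - 1)"
    proof (cases "H \<le> 1")
      case True
      have "s powr (H - 1) \<le> (t/2) powr (H - 1)"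
        using True t that by (intro powr_mono2') auto
      moreover have "0 \<le> (2 * t) powr (H - 1)" by simp
      ultimately show ?thesis by linarith
    next
      case False
      have "s powr (H - 1) \<le> (2 * t) powr (H - 1)"
        using False t that by (intro powr_mono2) auto
      moreover have "0 \<le> (t/2) powr (H - 1)" by simp
      ultimately show ?thesis by linarith
    qed
    then show ?thesis unfolding K_def by (simp add: abs_mult mult_left_mono)
  qed
  have "((\<lambda>s. LINT z|lborel. ?I z * (?n z * heat f (s powr H * z))) has_real_derivative
      (LINT z|lborel. ?f' t z)) (at t)"
  proof (rule has_real_derivative_integral[where a = "t/2" and b = "2 * t" and
        g = "\<lambda>z. K / 2 * C1 * (?n z * \<bar>z\<bar> ^ 1)"])
    show "integrable lborel (\<lambda>z. ?I z * (?n z * heat f (s powr H * z)))" for s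
      using integrable_mult_indicator[OF _ integrable_std_normal_times_bounded[of "\<lambda>z. heat f (s powr H * z)" C 0], of "{0<..}"]
        hb by simp
    show "((\<lambda>s. ?I z * (?n z * heat f (s powr H * z))) has_real_derivative ?f' s z) (at s)"
      if "s \<in> {t/2<..<2 * t}" for s z
    \<comment> \<open>For \<open>z > 0\<close> the argument of \<open>heat f\<close> is positive,
      where it is differentiable; otherwise the indicator makes both sides 0.\<close>
    proof (cases "z > 0")
      case True
      have s: "s > 0" using that t by simp
      have "((\<lambda>s. heat f (s powr H * z)) has_real_derivative
          heat (laplacian f) (s powr H * z) / 2 * (?c s * z)) (at s)"
        by (rule DERIV_chain2[OF heat_has_real_derivative[OF f]])
          (use s True in \<open>auto intro!: derivative_eq_intros\<close>)
      then have "((\<lambda>s. ?n z * heat f (s powr H * z)) has_real_derivative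
          ?n z * (heat (laplacian f) (s powr H * z) / 2 * (?c s * z))) (at s)"
        by (rule DERIV_cmult)
      then show ?thesis using True by (simp add: mult_ac)
    qed simp
    show "\<bar>?f' s z\<bar> \<le> K / 2 * C1 * (?n z * \<bar>z\<bar> ^ 1)" if "s \<in> {t/2<..<2 * t}" for s z
    proof -
      have "\<bar>?c s / 2 * heat (laplacian f) (s powr H * z)\<bar> \<le> K / 2 * C1"
        unfolding abs_mult using K[OF that] hb(2) by (intro mult_mono) (auto simp: K_def)
      then have "(?n z * \<bar>z\<bar>) * \<bar>?c s / 2 * heat (laplacian f) (s powr H * z)\<bar> \<le> (?n z * \<bar>z\<bar>) * (K / 2 * C1)"
        by (intro mult_left_mono) auto
      moreover have "\<bar>?f' s z\<bar> \<le> (?n z * \<bar>z\<bar>) * \<bar>?c s / 2 * heat (laplacian f) (s powr H * z)\<bar>"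
        unfolding abs_mult abs_indicator mult.assoc[symmetric]
        by (simp add: mult_left_le_one_le mult.assoc)
      ultimately show ?thesis by (simp add: mult_ac)
    qed
    show "?f' t \<in> borel_measurable lborel" by measurable
    show "integrable lborel (\<lambda>z. K / 2 * C1 * (?n z * \<bar>z\<bar> ^ 1))"
      by (intro integrable_mult_right integrable_std_normal_moment_abs)
  qed (use t in auto)
  \<comment> \<open>Integration by parts removes the factor \<open>z\<close>. The boundary value is
    \<open>heat (laplacian f) 0 = laplacian f 0\<close>, and differentiating
    \<open>heat (laplacian f)\<close> brings in the second Laplacian with a factor
    \<open>t powr H / 2\<close>.\<close>
  also have "(LINT z|lborel. ?f' t z) = ?c t / 2 * laplacian f 0 / sqrt (2 * pi) +
      (LINT z|lborel. ?I z * (?n z * (?c t / 2 *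
         (heat (laplacian (laplacian f)) (t powr H * z) / 2 * t powr H))))"
  proof (rule stein_identity_half_line)
    show "((\<lambda>z. ?c t / 2 * heat (laplacian f) (t powr H * z)) has_real_derivative
        ?c t / 2 * (heat (laplacian (laplacian f)) (t powr H * z) / 2 * t powr H)) (at z)" if "z > 0" for z
      by (intro DERIV_cmult DERIV_chain2[OF heat_has_real_derivative[OF lf]])
        (use t that in \<open>auto intro!: derivative_eq_intros\<close>)
    have scale: "continuous_on UNIV (\<lambda>z. t powr H * z)"
      by (intro continuous_intros)
    have "continuous_on UNIV (\<lambda>z. heat (laplacian (laplacian f)) (t powr H * z))"
      by (rule continuous_on_compose2[OF hc(3)[of UNIV] scale]) simp
    then have "continuous_on UNIV (\<lambda>z. ?c t / 2 * (heat (laplacian (laplacian f)) (t powr H * z) / 2 * t powr H))"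
      by (intro continuous_on_mult_left continuous_on_mult_right continuous_on_divide continuous_on_const) auto
    then show "isCont (\<lambda>z. ?c t / 2 * (heat (laplacian (laplacian f)) (t powr H * z) / 2 * t powr H)) z" for z
      by (simp add: continuous_on_eq_continuous_at)
    \<comment> \<open>The sum of the two nonnegative bounds serves as the single constant that
      \<open>stein_identity_half_line\<close> takes.\<close>
    let ?K = "\<bar>?c t / 2\<bar> * C1 + \<bar>?c t / 2\<bar> * (C2 / 2 * t powr H)"
    have "0 \<le> C1" "0 \<le> C2" using C1[of 0] C2[of 0] by linarith+
    then have nn: "0 \<le> \<bar>?c t / 2\<bar> * C1" "0 \<le> \<bar>?c t / 2\<bar> * (C2 / 2 * t powr H)"
      by (intro mult_nonneg_nonneg; simp)+
    have "\<bar>?c t / 2 * heat (laplacian f) (t powr H * z)\<bar> \<le> \<bar>?c t / 2\<bar> * C1" for z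
      unfolding abs_mult[of "?c t / 2"] by (intro mult_left_mono hb) auto
    from this nn show "\<bar>?c t / 2 * heat (laplacian f) (t powr H * z)\<bar> \<le> ?K" for z
      by (meson add_increasing add_increasing2 order_trans order_refl)
    have "\<bar>?c t / 2 * (heat (laplacian (laplacian f)) (t powr H * z) / 2 * t powr H)\<bar>
        \<le> \<bar>?c t / 2\<bar> * (C2 / 2 * t powr H)" for z
      unfolding abs_mult[of "?c t / 2"] using hb(3) by (intro mult_left_mono) (auto simp: abs_mult mult_right_mono)
    from this nn show "\<bar>?c t / 2 * (heat (laplacian (laplacian f)) (t powr H * z) / 2 * t powr H)\<bar> \<le> ?K" for z
      by (meson add_increasing add_increasing2 order_trans order_refl)
    have "continuous_on UNIV (\<lambda>z. heat (laplacian f) (t powr H * z))"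
      by (rule continuous_on_compose2[OF hc(2)[of UNIV] scale]) simp
    then have "continuous_on UNIV (\<lambda>z. ?c t / 2 * heat (laplacian f) (t powr H * z))"
      by (rule continuous_on_mult_left)
    then have "isCont (\<lambda>z. ?c t / 2 * heat (laplacian f) (t powr H * z)) 0"
      by (simp add: continuous_on_eq_continuous_at)
    then have "((\<lambda>z. ?c t / 2 * heat (laplacian f) (t powr H * z)) \<longlongrightarrow> ?c t / 2 * laplacian f 0) (at 0)"
      by (simp add: isCont_def heat_0)
    then show "((\<lambda>z. ?c t / 2 * heat (laplacian f) (t powr H * z)) \<longlongrightarrow> ?c t / 2 * laplacian f 0) (at_right 0)"
      by (rule filterlim_mono[OF _ order_refl at_le]) simp
  qed measurable
  also have "(LINT z|lborel. ?I z * (?n z * (?c t / 2 *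
         (heat (laplacian (laplacian f)) (t powr H * z) / 2 * t powr H)))) =
      H * t powr (2*H - 1) / 2^2 *
       (LINT z|lborel. ?I z * (?n z * heat (laplacian (laplacian f)) (t powr H * z)))"
  proof -
    have "t powr (H - 1) * t powr H = t powr (2*H - 1)" by (simp flip: powr_add)
    then have eq: "?c t / 2 * (x / 2 * t powr H) = H * t powr (2*H - 1) / 2^2 * x" for x
      by (simp add: mult_ac)
    have pull: "(LINT z|lborel. ?I z * (?n z * (c * h z))) = c * (LINT z|lborel. ?I z * (?n z * h z))" for c h
      by (simp add: mult.left_commute[of _ c])
    show ?thesis unfolding eq pull ..
  qed
  finally show ?thesis
    \<comment> \<open>The 2 from folding the normal law cancels the half in the boundary term and
      stays with the half-line integral in the other.\<close>
    by (rule DERIV_cong[OF DERIV_cmult[where c = 2]]) (simp add: field_simps)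
qed

text \<open>The equation is stated weakly in space: the time derivative is that of the pairing with
  a fixed \<open>\<phi>\<close>, and the Laplacians are moved onto \<open>\<phi>\<close>.\<close>

theorem mainTheorem4:
  fixes M :: "'w measure"
    and H :: real
    and B :: "'n::finite \<Rightarrow> real \<Rightarrow> 'w \<Rightarrow> real"
    and B\<^sub>H :: "real \<Rightarrow> 'w \<Rightarrow> real"
    and q :: "real^'n \<Rightarrow> real \<Rightarrow> real"
  assumes "prob_space M"
    and "0 < H" and "H < 1"
    and "\<And>j. standard_brownian_motion M (B j)"
    and "fractional_brownian_motion M H B\<^sub>H"
    and "independent_processes M B B\<^sub>H"
    and "\<And>x t. t > 0 \<Longrightarrow> q x t \<ge> 0"
    and "\<And>t. t > 0 \<Longrightarrow>
           distributed M lborel (\<lambda>\<omega>. \<chi> j. B j \<bar>B\<^sub>H t \<omega>\<bar> \<omega>) (\<lambda>x. ennreal (q x t))"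
  shows "\<forall>t>0. \<forall>\<phi>. test_function \<phi> \<longrightarrow>
    ((\<lambda>s. regular_distribution (\<lambda>x. q x s) \<phi>) has_real_derivative
       (H * t powr (2*H - 1) / sqrt (2 * pi * t powr (2*H)) *
          distribution_laplacian dirac_delta \<phi> +
        H * t powr (2*H - 1) / 2^2 *
          distribution_laplacian (distribution_laplacian
            (regular_distribution (\<lambda>x. q x t))) \<phi>)) (at t)"
proof (intro allI impI)
  fix t :: real and \<phi> :: "real^'n \<Rightarrow> real"
  assume t: "t > 0" and \<phi>: "test_function \<phi>"
  \<comment> \<open>For \<open>s > 0\<close> and a test function \<open>f\<close> this is the
    expectation of \<open>heat f\<close> at \<open>\<bar>B\<^sub>H s \<omega>\<bar>\<close>, since
    \<open>B\<^sub>H s\<close> has standard deviation \<open>s powr H\<close>.\<close>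
  let ?R = "\<lambda>f s. 2 * (LINT z|lborel. indicator {0<..} z * (std_normal_density z * heat f (s powr H * z)))"
  have fbm: "distributed M lborel (B\<^sub>H s) (\<lambda>x. ennreal (normal_density 0 (s powr H) x))" if "s > 0" for s
  proof (rule gaussian_rv_centered_distributed[OF assms(1)])
    note fBm = assms(5)[unfolded fractional_brownian_motion_def]
    from fBm have "gaussian_process M {0..} B\<^sub>H" by blast
    \<comment> \<open>The one-time marginal is the linear combination over \<open>{s}\<close> with
      coefficient 1.\<close>
    from this[unfolded gaussian_process_def, rule_format, of "{s}" "\<lambda>_. 1"] that
    show "gaussian_rv M (B\<^sub>H s)" by simp
    have s: "0 \<le> s" using that by simp
    from fBm[THEN conjunct2, THEN conjunct1, rule_format, OF s]
    show "(LINT \<omega>|M. B\<^sub>H s \<omega>) = 0" .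
    from fBm[THEN conjunct2, THEN conjunct2, rule_format, OF s s]
    have "(LINT \<omega>|M. B\<^sub>H s \<omega> * B\<^sub>H s \<omega>) = s powr (2 * H)" using that by simp
    also have "\<dots> = (s powr H)\<^sup>2"
      unfolding power2_eq_square powr_add[symmetric] by simp
    finally show "(LINT \<omega>|M. B\<^sub>H s \<omega> * B\<^sub>H s \<omega>) = (s powr H)\<^sup>2" .
  qed (use that in simp)
  \<comment> \<open>Proved for every test function, since it is applied both to
    \<open>\<phi>\<close> and to its iterated Laplacian.\<close>
  have reg: "regular_distribution (\<lambda>x. q x s) f = ?R f s" if f: "test_function f" and s: "s > 0" for f s
  proof -
    obtain C where C: "\<And>x. \<bar>f x\<bar> \<le> C" using test_function_bounded[OF f] by blast
    note X = assms(8)[OF s]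
    have Y: "B\<^sub>H s \<in> borel_measurable M"
      using distributed_measurable[OF fbm[OF s]] by simp
    have "regular_distribution (\<lambda>x. q x s) f = (LINT \<omega>|M. f (\<chi> j. B j \<bar>B\<^sub>H s \<omega>\<bar> \<omega>))"
      unfolding regular_distribution_def using assms(7)[OF s] test_function_measurable[OF f]
      by (intro distributed_integral[OF X]) auto
    \<comment> \<open>Measurability of the vector at the random time is contained in the assumption
      that it has a density.\<close>
    also have "\<dots> = (LINT \<omega>|M. heat f \<bar>B\<^sub>H s \<omega>\<bar>)"
      using s distributed_measurable[OF X]
      by (intro expectation_brownian_vec_random_time[OF assms(1,4,6) test_function_continuous_on[OF f] C _ Y]) auto
    also have "\<dots> = ?R f s"
      using s abs_heat_le[OF test_function_measurable[OF f] C]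
      by (intro expectation_abs_normal[OF assms(1) fbm[OF s]]
          borel_measurable_continuous_onI[OF continuous_on_heat[OF test_function_continuous_on[OF f] C]]) auto
    finally show ?thesis .
  qed
  have "2 * H - 1 = (H - 1) + H" by simp
  then have "t powr (2*H - 1) = t powr (H - 1) * t powr H" by (simp only: powr_add)
  moreover have "sqrt (2 * pi * t powr (2*H)) = sqrt (2 * pi) * t powr H"
  proof -
    have "2 * pi * t powr (2*H) = (2 * pi) * (t powr H)\<^sup>2"
      unfolding power2_eq_square powr_add[symmetric] by simp
    then show ?thesis by (simp add: real_sqrt_mult)
  qed
  ultimately have "H * t powr (2*H - 1) / sqrt (2 * pi * t powr (2*H)) = H * t powr (H - 1) / sqrt (2 * pi)"
    using t by simp
  with has_real_derivative_heat_abs_normal[OF \<phi> t, of H]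
  have "(?R \<phi> has_real_derivative
       (H * t powr (2*H - 1) / sqrt (2 * pi * t powr (2*H)) *
          distribution_laplacian dirac_delta \<phi> +
        H * t powr (2*H - 1) / 2^2 *
          distribution_laplacian (distribution_laplacian
            (regular_distribution (\<lambda>x. q x t))) \<phi>)) (at t)"
    by (simp only: distribution_laplacian_def dirac_delta_def
        reg[OF test_function_laplacian[OF test_function_laplacian[OF \<phi>]] t])
  then show "((\<lambda>s. regular_distribution (\<lambda>x. q x s) \<phi>) has_real_derivative
       (H * t powr (2*H - 1) / sqrt (2 * pi * t powr (2*H)) *
          distribution_laplacian dirac_delta \<phi> +
        H * t powr (2*H - 1) / 2^2 *
          distribution_laplacian (distribution_laplacian
            (regular_distribution (\<lambda>x. q x t))) \<phi>)) (at t)"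
    \<comment> \<open>The pairing agrees with \<open>?R\<close> only at positive times, an open set
      containing \<open>t\<close>, which suffices for the derivative.\<close>
    by (rule has_field_derivative_transform_within_open[of _ _ _ "{0<..}"])
      (use t in \<open>auto simp: reg[OF \<phi>]\<close>)
qed

end
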